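(* Let $G$ and $H$ be finite abelian groups with $|G|=n$ and $|H|=m$. Suppose that $$|m\mathcal P_G\cap\mathbb Z^n|=|n\mathcal P_H\cap\mathbb Z^m|.$$ Then, for every $0\le k<\min\{n,m\}$, one has $$\sum_{\substack{F\in\mathcal F(\mathcal P_G)\\ \dim F=k}}|mF^\circ\cap\mathbb Z^n|=\sum_{\substack{F\in\mathcal F(\mathcal P_H)\\ \dim F=k}}|nF^\circ\cap\mathbb Z^m|.$$
   Context: For a finite abelian group $G$ of order $n$ (written additively), let $\Delta_G=\{x=(x_g)_{g\in G}\in\mathbb R_{\ge0}^G:\sum_g x_g=1\}$ and let $\Lambda_G=\{(a_g)_{g\in G}\in\mathbb Z^G:\sum_g a_g g=0 \text{ in } G\}$, a full-rank sublattice of $\mathbb Z^G$. Choose a linear isomorphism $T:\mathbb R^G\to\mathbb R^n$ with $T(\Lambda_G)=\mathbb Z^n$; the zero-sum polytope of $G$ is $\mathcal P_G=T(\Delta_G)\subseteq\mathbb R^n$, a rational simplex of dimension $n-1$. (The choice of $T$ does not affect any of the lattice-point counts below.) Likewise $\mathcal P_H\subseteq\mathbb R^{m}$ for $H$ of order $m$. $\mathcal F(\mathcal P)$ denotes the set of faces of a polytope $\mathcal P$ (including $\mathcal P$ itself), and $F^\circ$ denotes the relative interior of $F$. For a set $X$ in a real vector space and an integer $k$, $kX=\{kx:x\in X\}$. *)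

theory Defs
  imports "HOL-Analysis.Analysis"
begin

text \<open>
  A finite abelian group \<open>G\<close> is a type \<open>'g\<close> of class \<open>{finite, ab_group_add}\<close>, so that
  \<open>\<real>\<^sup>G\<close> is \<^typ>\<open>real ^ 'g\<close>.  Likewise \<open>\<real>\<^sup>n\<close> is \<^typ>\<open>real ^ 'n\<close> for an index type \<open>'n\<close>.
\<close>

definition int_multiple :: "int \<Rightarrow> 'g::ab_group_add \<Rightarrow> 'g" where
  "int_multiple k g =
     (if k \<ge> 0 then (\<Sum>i<nat k. g) else - (\<Sum>i<nat (- k). g))"

definition coord_simplex :: "(real ^ 'g::finite) set" where
  "coord_simplex = {x. (\<forall>g. x $ g \<ge> 0) \<and> (\<Sum>g\<in>UNIV. x $ g) = 1}"

definition zero_sum_lattice :: "(real ^ 'g::{finite, ab_group_add}) set" where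
  "zero_sum_lattice =
     {(\<chi> g. real_of_int (a g)) | a :: 'g \<Rightarrow> int. (\<Sum>g\<in>UNIV. int_multiple (a g) g) = 0}"

definition integer_points :: "(real ^ 'n::finite) set" where
  "integer_points = {x. \<forall>i. x $ i \<in> \<int>}"

text \<open>The isomorphism \<open>T\<close> in the definition of \<open>\<P>\<^sub>G\<close>; being a linear bijection it forces
  \<open>CARD('n) = CARD('g)\<close>.\<close>

definition lattice_iso :: "(real ^ 'g::{finite, ab_group_add} \<Rightarrow> real ^ 'n::finite) \<Rightarrow> bool" where
  "lattice_iso T \<longleftrightarrow> linear T \<and> bij T \<and> T ` zero_sum_lattice = integer_points"

definition zero_sum_polytope ::
    "(real ^ 'g::{finite, ab_group_add} \<Rightarrow> real ^ 'n::finite) \<Rightarrow> (real ^ 'n) set" where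
  "zero_sum_polytope T = T ` coord_simplex"

definition dilate :: "nat \<Rightarrow> 'a::real_vector set \<Rightarrow> 'a set" where
  "dilate k X = (\<lambda>x. real k *\<^sub>R x) ` X"

text \<open>The empty set is a \<open>face_of\<close> every set, but it has \<open>aff_dim\<close> \<open>-1\<close>, so it is not in
  \<open>faces_of_dim k P\<close> for any \<open>k\<close>.\<close>

definition faces_of_dim :: "nat \<Rightarrow> 'a::euclidean_space set \<Rightarrow> 'a set set" where
  "faces_of_dim k P = {F. F face_of P \<and> aff_dim F = int k}"

end

(* A lattice point of the m-th dilate of the polytope of G is a zero-sum multiset of size m over G,
   and the relative interior of a k-dimensional face collects the multisets with a prescribed support
   of k + 1 elements. By character orthogonality, the zero-sum multisets of size m, weighted by u to
   the size of the support, have weight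

     1/n * sum over characters xi of [X^m] prod_g (1 - (1-u) xi(g) X) / (1 - xi(g) X),

   and for a character of order d the product is ((1 - (1-u)^d X^d) / (1 - X^d))^(n/d). Hence the
   weight is a sum over d dividing gcd n m of the number of characters of order d times a quantity
   that is symmetric in n and m. So it suffices that G and H have equally many characters of order d
   for every d dividing gcd n m. At u = 1 the hypothesis becomes the vanishing of the sum of
   (o_G(d) - o_H(d)) * binomial((n+m)/d, m/d), and the first d with o_G(d) <> o_H(d) would dominate
   all later terms: there the difference is a multiple of d by Frobenius' theorem. *)
theory Submission
  imports Defs
    "HOL-Computational_Algebra.Computational_Algebra"
    "HOL-Algebra.Sylow"
    "HOL-Algebra.Multiplicative_Group"
begin

text \<open>The obstacle is the domination step. Write n = d * N. Every e >= 2 * d has a binomial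
  smaller by a factor of at least N + 1, and as there are at most n = d * N characters in all, these
  terms together stay below d times the binomial at d. For d < e < 2 * d the gain used is only 1 + N
  / d, too little for that many characters. The extra input is that cumulative counts (orders
  dividing x) are multiplicative over coprime divisors. This forces the first difference d to be a
  prime power, and it leaves between d and 2 * d only those e that are coprime to d, where
  characters are few. The counts are of characters, not of group elements; what is used of the
  characters is that they form a commutative group of n elements.\<close>

no_notation fps_nth (infixl "$" 75)

subsection \<open>Binomial coefficients at proportional arguments\<close>

text \<open>As products over the indices 1 to M, two binomials can be compared factor by
  factor.\<close>

lemma binomial_eq_prod:
  "real ((N + M) choose M) = (\<Prod>i\<in>{1..M}. 1 + real N / real i)"
proof (induction M)
  case 0
  then show ?case by simp
next
  case (Suc M)
  have "Suc M * ((N + Suc M) choose Suc M) = (N + Suc M) * ((N + M) choose M)"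
    using Suc_times_binomial_eq[of "N + M" M] by (simp add: ac_simps)
  then have "real (Suc M) * real ((N + Suc M) choose Suc M) = real (N + Suc M) * real ((N + M) choose M)"
    by (metis of_nat_mult)
  then have "real ((N + Suc M) choose Suc M) = real ((N + M) choose M) * (1 + real N / real (Suc M))"
    by (simp add: field_simps del: binomial_Suc_Suc)
  then show ?case
    using Suc by (simp add: prod.atLeast_Suc_atMost_Suc_shift prod.nat_ivl_Suc' mult.commute del: binomial_Suc_Suc)
qed

text \<open>In the product formula the factor \<open>j\<close> of the smaller binomial is at most the factor
  \<open>e * j div d\<close> of the larger one, so the skipped indices \<open>E\<close> give a gain.\<close>

lemma binomial_dilate_bound:
  fixes d e :: nat
  assumes d: "0 < d" "d < e" and N: "d * N = e * N'" and M: "d * M = e * M'"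
    and E: "E \<subseteq> {1..M}" "\<And>j. j \<in> {1..M'} \<Longrightarrow> e * j div d \<notin> E"
  shows "real ((N' + M') choose M') * (\<Prod>i\<in>E. 1 + real N / real i) \<le> real ((N + M) choose M)"
proof -
  define \<phi> where "\<phi> j = e * j div d" for j
  \<comment> \<open>Since d < e, raising j by 1 raises e * j / d by more than 1, so rounding down
    cannot merge two indices.\<close>
  have step: "\<phi> j < \<phi> (Suc j)" for j
  proof -
    have "\<phi> j < (e * j + d) div d" using d by (simp add: \<phi>_def)
    also have "\<dots> \<le> \<phi> (Suc j)" unfolding \<phi>_def using d by (intro div_le_mono) simp
    finally show ?thesis .
  qed
  then have mono: "strict_mono \<phi>" by (simp add: strict_mono_Suc_iff)
  have inj: "inj_on \<phi> {1..M'}" using mono by (simp add: strict_mono_imp_inj_on)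
  have "\<phi> M' = M" using d M[symmetric] by (simp add: \<phi>_def)
  then have le: "\<phi> j \<le> M" if "j \<le> M'" for j
    using mono that by (metis strict_mono_less_eq)
  have "\<phi> 0 = 0" by (simp add: \<phi>_def)
  then have pos: "\<phi> j \<ge> 1" if "j \<ge> 1" for j
    using mono that by (metis One_nat_def Suc_leI less_le_trans strict_mono_less zero_less_one)
  have img: "\<phi> ` {1..M'} \<subseteq> {1..M}" using le pos by auto
  \<comment> \<open>N' / j = N / (e * j / d), and rounding e * j / d down to \<phi> j only enlarges
    the factor.\<close>
  have fac: "1 + real N' / real j \<le> 1 + real N / real (\<phi> j)" if "j \<in> {1..M'}" for j
  proof -
    have "\<phi> j * d \<le> e * j" by (simp add: \<phi>_def)
    then have *: "real (\<phi> j) * real d \<le> real e * real j" by (metis of_nat_le_iff of_nat_mult)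
    have "real d * (real N' * real (\<phi> j)) = (real (\<phi> j) * real d) * real N'" by simp
    also have "\<dots> \<le> (real e * real j) * real N'" using * by (intro mult_right_mono) auto
    also have "\<dots> = real d * (real N * real j)"
      using arg_cong[OF N, of real] by (simp add: algebra_simps)
    finally have "real N' * real (\<phi> j) \<le> real N * real j" using d by simp
    then show ?thesis using that pos[of j] by (simp add: frac_le_eq field_simps)
  qed
  have "real ((N' + M') choose M') \<le> (\<Prod>j\<in>{1..M'}. 1 + real N / real (\<phi> j))"
    unfolding binomial_eq_prod using fac by (intro prod_mono) auto
  also have "\<dots> = (\<Prod>i\<in>\<phi> ` {1..M'}. 1 + real N / real i)"
    using inj by (simp add: prod.reindex)
  finally have "real ((N' + M') choose M') * (\<Prod>i\<in>E. 1 + real N / real i)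
      \<le> (\<Prod>i\<in>\<phi> ` {1..M'}. 1 + real N / real i) * (\<Prod>i\<in>E. 1 + real N / real i)"
    by (intro mult_right_mono prod_nonneg) auto
  also have "\<dots> = (\<Prod>i\<in>\<phi> ` {1..M'} \<union> E. 1 + real N / real i)"
    using E finite_subset[OF E(1)] by (subst prod.union_disjoint) (auto simp: \<phi>_def)
  also have "\<dots> \<le> (\<Prod>i\<in>{1..M}. 1 + real N / real i)"
    using img E by (intro prod_mono2) auto
  finally show ?thesis by (simp add: binomial_eq_prod)
qed

text \<open>For e >= 2 * d the index \<open>e * j div d\<close> is at least 2 * j, so index 1 is
  skipped and contributes its factor N + 1. For M >= 3 a second index, at most 3, is skipped as
  well.\<close>

lemma binomial_dilate_bound_double:
  fixes d e :: nat
  assumes d: "0 < d" "2 * d \<le> e" and N: "d * N = e * N'" and M: "d * M = e * M'" "0 < M"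
  shows "real ((N' + M') choose M') * (real N + 1) \<le> real ((N + M) choose M)"
    and "3 \<le> M \<Longrightarrow> real ((N' + M') choose M') * ((real N + 1) * (1 + real N / 3)) \<le> real ((N + M) choose M)"
proof -
  have \<phi>: "2 * j \<le> e * j div d" for j
  proof -
    have "2 * d * j \<le> e * j" using d by (intro mult_le_mono1)
    then show ?thesis using d by (simp add: less_eq_div_iff_mult_less_eq ac_simps)
  qed
  have "real ((N' + M') choose M') * (\<Prod>i\<in>{1}. 1 + real N / real i) \<le> real ((N + M) choose M)"
  proof (rule binomial_dilate_bound[OF d(1) _ N M(1)])
    show "e * j div d \<notin> {1}" if "j \<in> {1..M'}" for j using \<phi>[of j] that by auto
  qed (use d M in auto)
  then show "real ((N' + M') choose M') * (real N + 1) \<le> real ((N + M) choose M)"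
    by (simp add: add.commute)
  assume M3: "3 \<le> M"
  \<comment> \<open>Every j >= 2 is sent to 4 or more, so only the image \<open>e div d\<close> of j
    = 1 can occupy 2 or 3, and one of them is free. The worse case i = 3 yields the factor 1 + N /
    3.\<close>
  define i :: nat where "i = (if e div d = 2 then 3 else 2)"
  have "real ((N' + M') choose M') * (\<Prod>i\<in>{1,i}. 1 + real N / real i) \<le> real ((N + M) choose M)"
  proof (rule binomial_dilate_bound[OF d(1) _ N M(1)])
    show "e * j div d \<notin> {1,i}" if "j \<in> {1..M'}" for j 
    proof (cases "j = 1")
      case True
      then show ?thesis using \<phi>[of 1] by (auto simp: i_def)
    next
      case False
      then have "4 \<le> e * j div d" using \<phi>[of j] that by auto
      then show ?thesis by (auto simp: i_def)
    qed
  qed (use d M3 in \<open>auto simp: i_def\<close>)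
  moreover have "(\<Prod>i\<in>{1,i}. 1 + real N / real i) = (1 + real N) * (1 + real N / real i)"
    by (subst prod.insert) (auto simp: i_def)
  moreover have "(real N + 1) * (1 + real N / 3) \<le> (1 + real N) * (1 + real N / real i)"
    by (auto simp: i_def field_simps)
  ultimately show "real ((N' + M') choose M') * ((real N + 1) * (1 + real N / 3)) \<le> real ((N + M) choose M)"
    by (smt (verit) mult_left_mono of_nat_0_le_iff)
qed

text \<open>Pigeonhole: the d - 1 indices j < d cannot cover 1..d, and every j >= d lands above d.
  The missed index i <= d gives 1 + N / i >= 1 + N / d. This is the bound used for e between d and 2
  * d.\<close>

lemma binomial_dilate_bound_next:
  fixes d e :: nat
  assumes d: "0 < d" "d < e" and N: "d * N = e * N'" and M: "d * M = e * M'" "d \<le> M"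
  shows "real ((N' + M') choose M') * (1 + real N / real d) \<le> real ((N + M) choose M)"
proof -
  have big: "d < e * j div d" if "d \<le> j" for j
  proof -
    have "Suc d * d \<le> e * j" using d that by (intro mult_mono) auto
    then have "Suc d \<le> e * j div d" using d by (simp add: less_eq_div_iff_mult_less_eq)
    then show ?thesis by simp
  qed
  have "card ((\<lambda>j. e * j div d) ` {1..<d}) \<le> d - 1"
    using card_image_le[of "{1..<d}"] by fastforce
  then have "card ((\<lambda>j. e * j div d) ` {1..<d}) < card {1..d}" using d by simp
  then obtain i where i: "i \<in> {1..d}" "i \<notin> (\<lambda>j. e * j div d) ` {1..<d}"
    by (metis card_mono finite_atLeastLessThan finite_imageI not_less subsetI)
  have "real ((N' + M') choose M') * (\<Prod>i\<in>{i}. 1 + real N / real i) \<le> real ((N + M) choose M)"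
  proof (rule binomial_dilate_bound[OF d N M(1)])
    show "e * j div d \<notin> {i}" if "j \<in> {1..M'}" for j
      using i that big[of j] by (cases "d \<le> j") force+
  qed (use i M in auto)
  moreover have "real N / real d \<le> real N / real i"
    using i by (intro divide_left_mono) auto
  ultimately show ?thesis
    by (simp, smt (verit) mult_left_mono of_nat_0_le_iff)
qed

subsection \<open>Order profiles\<close>

text \<open>The properties of the function counting the elements of each order in a finite abelian group
  of order \<open>n\<close> on which the comparison of two groups rests; divisibility is Frobenius' theorem.\<close>

definition order_profile :: "nat \<Rightarrow> (nat \<Rightarrow> nat) \<Rightarrow> bool" where
  "order_profile n v \<longleftrightarrow> n > 0 \<and> (\<Sum>e | e dvd n. v e) = n \<and>
     (\<forall>d. d dvd n \<longrightarrow> d dvd (\<Sum>e | e dvd d. v e)) \<and>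
     (\<forall>x y. coprime x y \<longrightarrow> x * y dvd n \<longrightarrow>
        (\<Sum>e | e dvd x * y. v e) = (\<Sum>e | e dvd x. v e) * (\<Sum>e | e dvd y. v e))"

lemma
  assumes "order_profile n v"
  shows order_profile_pos: "n > 0"
    and order_profile_total: "(\<Sum>e | e dvd n. v e) = n"
    and order_profile_dvd: "d dvd n \<Longrightarrow> d dvd (\<Sum>e | e dvd d. v e)"
    and order_profile_mult: "coprime x y \<Longrightarrow> x * y dvd n \<Longrightarrow>
        (\<Sum>e | e dvd x * y. v e) = (\<Sum>e | e dvd x. v e) * (\<Sum>e | e dvd y. v e)"
  using assms unfolding order_profile_def by blast+

lemma order_profile_1:
  assumes "order_profile n v"
  shows "v 1 = 1"
proof -
  have "n = n * (\<Sum>e | e dvd Suc 0. v e)"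
    using order_profile_mult[OF assms, of n 1] order_profile_total[OF assms] by simp
  moreover have "{e. e dvd Suc 0} = {1}" by auto
  ultimately show ?thesis using order_profile_pos[OF assms] by simp
qed

lemma sum_proper_divisors:
  fixes v :: "nat \<Rightarrow> nat"
  assumes "d > 0"
  shows "(\<Sum>e | e dvd d. v e) = v d + (\<Sum>e | e dvd d \<and> e < d. v e)"
proof -
  have "{e. e dvd d} = insert d {e. e dvd d \<and> e < d}"
    using assms by (auto dest: dvd_imp_le)
  then show ?thesis by (simp add: finite_subset[OF _ finite_lessThan[of d]])
qed

text \<open>Below d the profiles agree, so their cumulative counts agree at x and y, hence at x * y.
  A proper divisor of x * y is at most half of it, thus below d; subtracting those counts leaves the
  one at x * y. Applied both with x * y = d and with d < x * y < 2 * d.\<close>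

lemma order_profile_eq_mult:
  assumes v: "order_profile n v" and w: "order_profile m w"
    and eq: "\<And>e. e dvd n \<Longrightarrow> e dvd m \<Longrightarrow> e < d \<Longrightarrow> v e = w e"
    and xy: "coprime x y" "x < d" "y < d" "x * y dvd n" "x * y dvd m" "x * y < 2 * d"
  shows "v (x * y) = w (x * y)"
proof -
  have pos: "x * y > 0" using order_profile_pos[OF v] xy(4) by (metis dvd_0_left_iff gr0I)
  have F: "(\<Sum>e | e dvd z. v e) = (\<Sum>e | e dvd z. w e)" if z: "z < d" "z dvd x * y" for z
  proof (intro sum.cong refl eq)
    fix e assume e: "e \<in> {e. e dvd z}"
    show "e dvd n" "e dvd m" using e z xy dvd_trans by blast+
    have "z > 0" using z pos by (metis dvd_0_left_iff gr0I)
    then show "e < d" using e z by (auto dest: dvd_imp_le)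
  qed
  have "(\<Sum>e | e dvd x * y. v e) = (\<Sum>e | e dvd x * y. w e)"
    using order_profile_mult[OF v xy(1,4)] order_profile_mult[OF w xy(1,5)] F[OF xy(2)] F[OF xy(3)] by simp
  moreover have "(\<Sum>e | e dvd x * y \<and> e < x * y. v e) = (\<Sum>e | e dvd x * y \<and> e < x * y. w e)"
  proof (intro sum.cong refl eq)
    fix e assume e: "e \<in> {e. e dvd x * y \<and> e < x * y}"
    then show "e dvd n" "e dvd m" using xy dvd_trans by blast+
    from e obtain c where c: "x * y = e * c" by (auto elim: dvdE)
    with e have "c \<noteq> 0" "c \<noteq> 1" using pos by (auto simp: c)
    then have "2 \<le> c" by linarith
    then have "e * 2 \<le> x * y" unfolding c by (intro mult_le_mono2)
    then show "e < d" using xy by linarith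
  qed
  ultimately show ?thesis using sum_proper_divisors[OF pos, of v] sum_proper_divisors[OF pos, of w] by simp
qed

text \<open>If d had two different prime factors, it would split into coprime factors below d, and
  \<open>order_profile_eq_mult\<close> would force agreement at d.\<close>

lemma order_profile_first_difference_prime_power:
  assumes v: "order_profile n v" and w: "order_profile m w"
    and eq: "\<And>e. e dvd n \<Longrightarrow> e dvd m \<Longrightarrow> e < d \<Longrightarrow> v e = w e"
    and d: "d dvd n" "d dvd m" "v d \<noteq> w d"
  obtains p a where "prime p" "a > 0" "d = p ^ a"
proof -
  have d0: "d > 0" using order_profile_pos[OF v] d by (metis dvd_0_left_iff gr0I)
  moreover have "d \<noteq> 1" using d order_profile_1[OF v] order_profile_1[OF w] by auto
  ultimately obtain p where p: "prime p" "p dvd d" using prime_factor_nat by blast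
  obtain a r where ar: "d = p ^ a * r" "\<not> p dvd r"
    by (metis d0 p(1) multiplicity_decompose' not_prime_unit less_numeral_extra(3))
  have a: "a > 0" using ar p by (cases a) auto
  have "r = 1"
  proof (rule ccontr)
    assume r: "r \<noteq> 1"
    have r2: "r \<ge> 2" using r ar d0 by (cases r) auto
    have "p ^ a > 1" using a p by (meson one_less_power prime_gt_1_nat)
    then have "r < d" "p ^ a < d" using ar r2 by (auto simp: prime_gt_0_nat[OF p(1)])
    moreover have "coprime (p ^ a) r" using ar p by (simp add: coprime_power_left_iff prime_imp_coprime)
    ultimately have "v (p ^ a * r) = w (p ^ a * r)"
      using d0 d ar(1) by (intro order_profile_eq_mult[OF v w eq]) auto
    then show False using d ar by simp
  qed
  then show ?thesis using that[OF p(1) a] ar by simp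
qed

text \<open>With n = p ^ b * y and p not dividing y, the orders prime to p are divisors of y. The
  cumulative count at p ^ b is a positive multiple of p ^ b, and its product with the one at y is n;
  so the latter is at most y, and p ^ a <= p ^ b.\<close>

lemma order_profile_sum_coprime_le:
  assumes v: "order_profile n v" and p: "prime p" "a > 0" "p ^ a dvd n"
  shows "(\<Sum>e | e dvd n \<and> coprime e (p ^ a). v e) \<le> n div p ^ a"
proof -
  have n: "n > 0" by (rule order_profile_pos[OF v])
  obtain b y where y: "n = p ^ b * y" "\<not> p dvd y"
    by (metis n p(1) multiplicity_decompose' not_prime_unit less_numeral_extra(3))
  have cop: "coprime (p ^ b) y" using y p by (simp add: coprime_power_left_iff prime_imp_coprime)
  have "p ^ a dvd p ^ b"
    using p y by (metis coprime_dvd_mult_left_iff coprime_power_left_iff prime_imp_coprime)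
  then have ab: "p ^ a \<le> p ^ b" using p by (simp add: dvd_imp_le prime_gt_0_nat)
  have "{e. e dvd n \<and> coprime e (p ^ a)} \<subseteq> {e. e dvd y}"
  proof safe
    fix e assume "e dvd n" "coprime e (p ^ a)"
    then have "e dvd p ^ b * y" "coprime e (p ^ b)" using y p by auto
    then show "e dvd y" by (simp add: coprime_dvd_mult_right_iff)
  qed
  moreover have "y > 0" using n y by (cases y) auto
  ultimately have "(\<Sum>e | e dvd n \<and> coprime e (p ^ a). v e) \<le> (\<Sum>e | e dvd y. v e)"
    by (intro sum_mono2) auto
  also have "\<dots> \<le> y"
  proof -
    have prod: "n = (\<Sum>e | e dvd p ^ b. v e) * (\<Sum>e | e dvd y. v e)"
      using order_profile_mult[OF v cop] order_profile_total[OF v] y by simp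
    have "p ^ b dvd (\<Sum>e | e dvd p ^ b. v e)"
      using order_profile_dvd[OF v] y by simp
    then have "p ^ b \<le> (\<Sum>e | e dvd p ^ b. v e)" using prod n by (intro dvd_imp_le) auto
    then have "p ^ b * (\<Sum>e | e dvd y. v e) \<le> p ^ b * y"
      using prod y by (metis mult_le_mono1)
    then show ?thesis using p by (simp add: prime_gt_0_nat)
  qed
  also have "y \<le> n div p ^ a"
    using y ab p by (simp add: less_eq_div_iff_mult_less_eq prime_gt_0_nat mult.commute)
  finally show ?thesis .
qed

text \<open>The proper divisors of d contribute equally, so w d - v d is a difference of two
  cumulative counts that are both divisible by d. Being positive, it is at least d.\<close>

lemma order_profile_first_difference_ge:
  assumes v: "order_profile n v" and w: "order_profile m w"
    and eq: "\<And>e. e dvd n \<Longrightarrow> e dvd m \<Longrightarrow> e < d \<Longrightarrow> v e = w e"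
    and d: "d dvd n" "d dvd m" "v d < w d"
  shows "v d + d \<le> w d"
proof -
  have d0: "d > 0" using order_profile_pos[OF v] d by (metis dvd_0_left_iff gr0I)
  have "(\<Sum>e | e dvd d \<and> e < d. v e) = (\<Sum>e | e dvd d \<and> e < d. w e)"
    using d dvd_trans by (intro sum.cong refl eq) auto
  then have "(\<Sum>e | e dvd d. w e) - (\<Sum>e | e dvd d. v e) = w d - v d"
    using sum_proper_divisors[OF d0, of v] sum_proper_divisors[OF d0, of w] by simp
  moreover have "d dvd (\<Sum>e | e dvd d. w e) - (\<Sum>e | e dvd d. v e)"
    using order_profile_dvd[OF v] order_profile_dvd[OF w] d by (intro dvd_diff_nat) auto
  ultimately have "d dvd w d - v d" by simp
  then have "d \<le> w d - v d" using d by (intro dvd_imp_le) auto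
  then show ?thesis using d by linarith
qed

text \<open>A later divisor \<open>e < 2 * d\<close> contributes only if it is coprime to the prime power \<open>d\<close>, since
  otherwise it splits into coprime factors below \<open>d\<close>. The elements whose order is coprime to \<open>d\<close>
  number at most \<open>n div d\<close>, which compensates for the weaker bound on binomials available there.\<close>

lemma order_profile_first_difference_less:
  fixes n m d :: nat
  defines "B \<equiv> \<lambda>e. real ((n div e + m div e) choose (m div e))"
  assumes v: "order_profile n v" and w: "order_profile m w"
    and eq: "\<And>e. e dvd n \<Longrightarrow> e dvd m \<Longrightarrow> e < d \<Longrightarrow> v e = w e"
    and d: "d dvd n" "d dvd m" "v d < w d"
  shows "(\<Sum>e | e dvd n \<and> e dvd m. real (v e) * B e) < (\<Sum>e | e dvd n \<and> e dvd m. real (w e) * B e)"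
proof -
  note n = order_profile_pos[OF v] and m = order_profile_pos[OF w]
  have ne: "v d \<noteq> w d" using d by simp
  obtain p a where pa: "prime p" "a > 0" "d = p ^ a"
    by (rule order_profile_first_difference_prime_power[OF v w eq d(1,2) ne]) blast+
  have d2: "d \<ge> 2" using pa by (metis One_nat_def Suc_leI one_less_power prime_gt_1_nat Suc_1)
  define N where "N = n div d"
  define M where "M = m div d"
  have nN: "n = d * N" and mM: "m = d * M" using d by (simp_all add: N_def M_def)
  have N0: "N > 0" and M0: "M > 0" using n m nN mM by (auto intro: gr0I)
  define D where "D = {e. e dvd n \<and> e dvd m}"
  have fin: "finite D" unfolding D_def using n by (intro finite_subset[OF _ finite_divisors_nat[OF n]]) auto
  \<comment> \<open>\<open>U1\<close> is the far range, with gain N + 1; \<open>U2\<close> is what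
    can remain of the near range d < e < 2 * d.\<close>
  define U1 where "U1 = {e\<in>D. 2 * d \<le> e}"
  define U2 where "U2 = {e\<in>D. d < e \<and> e < 2 * d \<and> coprime e d}"
  have B_pos: "B e \<ge> 0" for e by (simp add: B_def)
  have Bd: "B d > 0" by (simp add: B_def)
  have quot: "d * N = e * (n div e)" "d * M = e * (m div e)" if "e \<in> D" for e
    using that nN mM by (auto simp: D_def)
  \<comment> \<open>If e between d and 2 * d shares the prime p with d, then e = p ^ b * r with 0 <
    b < a, because d does not divide e. Both coprime factors are then below d.\<close>
  have skip: "v e = w e" if e: "e \<in> D" "e \<noteq> d" "e \<notin> U1" "e \<notin> U2" for e
  proof (cases "e < d")
    case True
    then show ?thesis using e by (auto simp: D_def intro: eq)
  next
    case False
    with e have e': "d < e" "e < 2 * d" "\<not> coprime e d" by (auto simp: U1_def U2_def)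
    then have "p dvd e"
      using pa by (metis coprime_commute coprime_power_left_iff prime_imp_coprime)
    obtain b r where br: "e = p ^ b * r" "\<not> p dvd r"
      by (metis e'(1) gr_implies_not_zero pa(1) multiplicity_decompose' not_prime_unit)
    have "b > 0" using br \<open>p dvd e\<close> by (cases b) auto
    have "\<not> d dvd e"
    proof
      assume "d dvd e"
      then obtain c where "e = d * c" by (auto elim: dvdE)
      with e' show False by (cases "c \<le> 1") (auto simp: not_le)
    qed
    then have "b < a" using pa br by (meson dvd_mult2 le_imp_power_dvd not_le)
    then have "p ^ b < d" using pa by (simp add: power_strict_increasing[OF _ prime_gt_1_nat])
    moreover have "r < d"
    proof -
      have "2 \<le> p ^ b" using pa \<open>b > 0\<close> by (metis One_nat_def Suc_1 Suc_leI one_less_power prime_gt_1_nat)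
      then have "2 * r \<le> e" unfolding br by (intro mult_le_mono1)
      then show ?thesis using e' by linarith
    qed
    moreover have "coprime (p ^ b) r" using br pa by (simp add: coprime_power_left_iff prime_imp_coprime)
    ultimately show ?thesis
      using e' e(1) unfolding br(1) D_def by (intro order_profile_eq_mult[OF v w eq]) auto
  qed
  have sumU1: "(\<Sum>e\<in>U1. real (v e)) \<le> real n"
  proof -
    have "(\<Sum>e\<in>U1. v e) \<le> (\<Sum>e | e dvd n. v e)"
      using n by (intro sum_mono2) (auto simp: U1_def D_def)
    also have "\<dots> = n" by (rule order_profile_total[OF v])
    finally show ?thesis by (metis of_nat_le_iff of_nat_sum)
  qed
  have sumU2: "(\<Sum>e\<in>U2. real (v e)) \<le> real N - 1"
  proof -
    \<comment> \<open>Order 1 is coprime to d but not in \<open>U2\<close>, so it takes one of the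
      at most N available elements; this is the -1.\<close>
    have "(\<Sum>e\<in>U2. v e) + v 1 = (\<Sum>e\<in>insert 1 U2. v e)"
      using d2 fin by (subst sum.insert) (auto simp: U2_def)
    also have "\<dots> \<le> (\<Sum>e | e dvd n \<and> coprime e (p ^ a). v e)"
      using n pa by (intro sum_mono2) (auto simp: U2_def D_def)
    also have "\<dots> \<le> N" unfolding N_def pa(3) using order_profile_sum_coprime_le[OF v pa(1,2)] d pa by simp
    finally have "real (\<Sum>e\<in>U2. v e) + 1 \<le> real N"
      using order_profile_1[OF v] by linarith
    then show ?thesis by simp
  qed
  \<comment> \<open>All later terms of v together weigh less than d copies of \<open>B d\<close>,
    the least amount by which w is ahead at d.\<close>
  have "(\<Sum>e\<in>U1. real (v e) * B e) + (\<Sum>e\<in>U2. real (v e) * B e) < real d * B d"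
  proof (cases "U2 = {}")
    case True
    \<comment> \<open>With at most n = d * N elements the gain N + 1 suffices: d * N / (N + 1) <
      d.\<close>
    have "B e * (real N + 1) \<le> B d" if "e \<in> U1" for e
      using binomial_dilate_bound_double(1)[of d e N "n div e" M "m div e"] quot[of e] that d2 M0
      by (auto simp: U1_def B_def N_def M_def)
    then have "B e \<le> B d / (real N + 1)" if "e \<in> U1" for e using that by (simp add: pos_le_divide_eq)
    then have "(\<Sum>e\<in>U1. real (v e) * B e) \<le> (\<Sum>e\<in>U1. real (v e) * (B d / (real N + 1)))"
      by (intro sum_mono mult_left_mono) auto
    also have "\<dots> = (\<Sum>e\<in>U1. real (v e)) * (B d / (real N + 1))" by (simp only: sum_distrib_right)
    also have "\<dots> \<le> real n * (B d / (real N + 1))" using sumU1 Bd by (intro mult_right_mono) auto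
    also have "\<dots> < real d * B d"
      using Bd d2 by (simp add: nN field_simps)
    finally show ?thesis using True by simp
  next
    case False
    then obtain r where r: "r \<in> U2" by blast
    \<comment> \<open>An order r in \<open>U2\<close> is prime to d, so it divides N and M, and both
      exceed d. This gives M >= 3 and d <= M, as the bounds applied below require.\<close>
    then have "coprime r d" "r dvd d * N" "r dvd d * M" using nN mM by (auto simp: U2_def D_def)
    then have "r dvd N" "r dvd M" by (simp_all add: coprime_dvd_mult_right_iff)
    then have rNM: "r \<le> N" "r \<le> M" using N0 M0 by (auto dest: dvd_imp_le)
    have dr: "d < r" using r by (simp add: U2_def)
    have "B e * ((real N + 1) * (1 + real N / 3)) \<le> B d" if "e \<in> U1" for e
      using binomial_dilate_bound_double(2)[of d e N "n div e" M "m div e"] quot[of e] that d2 M0 dr rNM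
      by (auto simp: U1_def B_def N_def M_def)
    then have "B e \<le> B d / ((real N + 1) * (1 + real N / 3))" if "e \<in> U1" for e
      using that by (subst pos_le_divide_eq) (auto intro!: mult_pos_pos add_pos_nonneg)
    then have "(\<Sum>e\<in>U1. real (v e) * B e) \<le> (\<Sum>e\<in>U1. real (v e) * (B d / ((real N + 1) * (1 + real N / 3))))"
      by (intro sum_mono mult_left_mono) auto
    also have "\<dots> = (\<Sum>e\<in>U1. real (v e)) * (B d / ((real N + 1) * (1 + real N / 3)))"
      by (simp only: sum_distrib_right)
    also have "\<dots> \<le> real n * (B d / ((real N + 1) * (1 + real N / 3)))"
      using sumU1 Bd by (intro mult_right_mono) auto
    finally have 1: "(\<Sum>e\<in>U1. real (v e) * B e) \<le> B d * (real d * real N / ((real N + 1) * (1 + real N / 3)))"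
      by (simp add: nN ac_simps)
    have "B e * (1 + real N / real d) \<le> B d" if "e \<in> U2" for e
      using binomial_dilate_bound_next[of d e N "n div e" M "m div e"] quot[of e] that d2 M0 dr rNM
      by (auto simp: U2_def B_def N_def M_def)
    then have "B e \<le> B d / (1 + real N / real d)" if "e \<in> U2" for e
      using that by (subst pos_le_divide_eq) (auto intro!: add_pos_nonneg)
    then have "(\<Sum>e\<in>U2. real (v e) * B e) \<le> (\<Sum>e\<in>U2. real (v e) * (B d / (1 + real N / real d)))"
      by (intro sum_mono mult_left_mono) auto
    also have "\<dots> = (\<Sum>e\<in>U2. real (v e)) * (B d / (1 + real N / real d))"
      by (simp only: sum_distrib_right)
    also have "\<dots> \<le> (real N - 1) * (B d / (1 + real N / real d))"
      using sumU2 Bd by (intro mult_right_mono) auto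
    finally have 2: "(\<Sum>e\<in>U2. real (v e) * B e) \<le> B d * ((real N - 1) / (1 + real N / real d))"
      by (simp add: ac_simps)
    \<comment> \<open>With x = N and y = d: the first summand is below 3 * y / (x + 2), the second
      equals y - y * (y + 1) / (x + y), and 3 / (x + 2) <= (y + 1) / (x + y) amounts to (x - 1) * (y
      - 2) >= 0.\<close>
    have "real d * real N / ((real N + 1) * (1 + real N / 3)) + (real N - 1) / (1 + real N / real d) < real d"
      (is "?x + ?y < _")
    proof -
      define x where "x = real N"
      define y where "y = real d"
      have xy: "x \<ge> 1" "y \<ge> 2" using N0 d2 by (auto simp: x_def y_def)
      have "?x = y * (3 * x / ((x + 1) * (x + 3)))"
        using xy by (simp add: x_def[symmetric] y_def[symmetric] divide_simps, (simp add: algebra_simps)?)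
      also have "3 * x / ((x + 1) * (x + 3)) < 3 / (x + 2)"
        using xy by (simp add: divide_simps, (simp add: algebra_simps)?)
      also have "3 / (x + 2) \<le> (y + 1) / (x + y)"
      proof -
        have "3 * (x + y) \<le> (y + 1) * (x + 2)"
          using mult_nonneg_nonneg[of "x - 1" "y - 2"] xy by (simp add: algebra_simps)
        then show ?thesis using xy by (simp add: divide_simps ac_simps)
      qed
      finally have "?x < y * ((y + 1) / (x + y))" using xy by simp
      moreover have "?y = y - y * ((y + 1) / (x + y))"
        using xy by (simp add: x_def[symmetric] y_def[symmetric] divide_simps, (simp add: algebra_simps)?)
      ultimately show ?thesis by (simp add: y_def)
    qed
    then have "B d * (?x + ?y) < B d * real d" using Bd by simp
    with 1 2 show ?thesis by (simp add: algebra_simps)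
  qed
  then have key: "(\<Sum>e\<in>U1. real (v e) * B e) + (\<Sum>e\<in>U2. real (v e) * B e) < real d * B d" .
  have split: "D = insert d (U1 \<union> U2 \<union> (D - insert d (U1 \<union> U2)))" and dU: "d \<notin> U1" "d \<notin> U2" "U1 \<inter> U2 = {}"
    using d d2 by (auto simp: D_def U1_def U2_def)
  have decomp: "(\<Sum>e\<in>D. f e) = f d + (sum f U1 + sum f U2) + sum f (D - insert d (U1 \<union> U2))" for f :: "nat \<Rightarrow> real"
  proof -
    have fU: "finite U1" "finite U2" using fin by (auto simp: U1_def U2_def)
    have "insert d (U1 \<union> U2) \<subseteq> D" using split by blast
    then have "sum f D = sum f (insert d (U1 \<union> U2)) + sum f (D - insert d (U1 \<union> U2))"
      using fin by (metis add.commute sum.subset_diff)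
    also have "sum f (insert d (U1 \<union> U2)) = f d + (sum f U1 + sum f U2)"
      using dU fU by (simp add: sum.union_disjoint)
    finally show ?thesis .
  qed
  have rest: "(\<Sum>e\<in>D - insert d (U1 \<union> U2). real (v e) * B e) = (\<Sum>e\<in>D - insert d (U1 \<union> U2). real (w e) * B e)"
    using skip by (intro sum.cong) auto
  have "v d + d \<le> w d" by (rule order_profile_first_difference_ge[OF v w eq d])
  then have "real (v d) + real d \<le> real (w d)" by linarith
  then have "(real (v d) + real d) * B d \<le> real (w d) * B d"
    using Bd by (intro mult_right_mono) auto
  moreover have "0 \<le> (\<Sum>e\<in>U1. real (w e) * B e)" "0 \<le> (\<Sum>e\<in>U2. real (w e) * B e)"
    using B_pos by (auto intro!: sum_nonneg)
  ultimately have "(\<Sum>e\<in>D. real (v e) * B e) < (\<Sum>e\<in>D. real (w e) * B e)"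
    using key rest unfolding decomp by (simp add: algebra_simps)
  then show ?thesis by (simp add: D_def)
qed

text \<open>At a first disagreement the profile with the larger count would have the strictly larger
  weighted sum. The two profiles may be exchanged because the binomial is symmetric in the two
  quotients.\<close>

lemma order_profile_eqI:
  assumes v: "order_profile n v" and w: "order_profile m w"
    and eq: "(\<Sum>e | e dvd n \<and> e dvd m. real (v e) * real ((n div e + m div e) choose (m div e)))
           = (\<Sum>e | e dvd n \<and> e dvd m. real (w e) * real ((n div e + m div e) choose (m div e)))"
    and d: "d dvd n" "d dvd m"
  shows "v d = w d"
  using d
proof (induction d rule: less_induct)
  case (less d)
  have sym: "(m div e + n div e) choose (n div e) = (n div e + m div e) choose (m div e)" for e
    using binomial_symmetric[of "n div e" "n div e + m div e"] by (simp add: add.commute)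
  have IH: "v e = w e" if "e dvd n" "e dvd m" "e < d" for e using that by (intro less.IH)
  show ?case
  proof (rule linorder_cases[of "v d" "w d"])
    assume "v d < w d"
    from order_profile_first_difference_less[OF v w IH less.prems this] eq show ?thesis by simp
  next
    assume "w d < v d"
    from order_profile_first_difference_less[OF w v IH[symmetric] less.prems(2,1) this] eq show ?thesis
      by (simp add: sym conj_commute)
  qed
qed

subsection \<open>Torsion in finite commutative groups\<close>

definition torsion :: "('a, 'b) monoid_scheme \<Rightarrow> nat \<Rightarrow> 'a set" where
  "torsion G k = {x \<in> carrier G. x [^]\<^bsub>G\<^esub> k = \<one>\<^bsub>G\<^esub>}"

lemma (in comm_group) subgroup_torsion: "subgroup (torsion G k) G"
  by (rule subgroupI) (auto simp: torsion_def nat_pow_inv pow_mult_distrib m_comm)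

text \<open>Turns the cumulative counts of \<open>order_profile\<close> into sizes of
  subgroups.\<close>

lemma (in comm_group) card_torsion_eq_sum:
  assumes "finite (carrier G)" "d > 0"
  shows "card (torsion G d) = (\<Sum>e | e dvd d. card {x \<in> carrier G. group.ord G x = e})"
proof -
  have "torsion G d = (\<Union>e\<in>{e. e dvd d}. {x \<in> carrier G. ord x = e})"
    by (auto simp: torsion_def pow_eq_id)
  also have "card \<dots> = (\<Sum>e | e dvd d. card {x \<in> carrier G. ord x = e})"
    using assms by (intro card_UN_disjoint) auto
  finally show ?thesis .
qed

text \<open>The abelian case of Frobenius' theorem. For a prime power p ^ a dividing d, Sylow's
  theorem gives a subgroup of order p ^ a. It lies in the torsion subgroup, so by Lagrange p ^ a
  divides the size of the latter. All prime powers together give d.\<close>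

lemma (in comm_group) dvd_card_torsion:
  assumes fin: "finite (carrier G)" and d: "d dvd order G"
  shows "d dvd card (torsion G d)"
proof -
  have n0: "order G > 0" using fin by (simp add: order_gt_0_iff_finite)
  then have d0: "d \<noteq> 0" using d by auto
  have TG: "group (G\<lparr>carrier := torsion G d\<rparr>)"
    by (rule subgroup.subgroup_is_group[OF subgroup_torsion is_group])
  have finT: "finite (torsion G d)" using fin by (simp add: torsion_def)
  then have T0: "card (torsion G d) \<noteq> 0" by (auto simp: torsion_def)
  have "p ^ a dvd card (torsion G d)" if p: "prime p" "p ^ a dvd d" for p a
  proof -
    have "p ^ a dvd order G" using p d dvd_trans by blast
    then obtain r where "order G = p ^ a * r" by (auto elim: dvdE)
    then obtain K where K: "subgroup K G" "card K = p ^ a"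
      using sylow_thm[OF p(1) is_group _ fin] by blast
    have KG: "group (G\<lparr>carrier := K\<rparr>)"
      by (rule subgroup.subgroup_is_group[OF K(1) is_group])
    have "K \<subseteq> torsion G d"
    proof
      fix x assume x: "x \<in> K"
      have "x [^]\<^bsub>G\<lparr>carrier := K\<rparr>\<^esub> p ^ a = \<one>\<^bsub>G\<lparr>carrier := K\<rparr>\<^esub>"
        using group.pow_order_eq_1[OF KG, of x] x K(2) by (simp add: order_def)
      then have "x [^] p ^ a = \<one>" by (simp add: nat_pow_consistent[symmetric])
      moreover have xG: "x \<in> carrier G" using x subgroup.subset[OF K(1)] by blast
      ultimately show "x \<in> torsion G d"
        using p pow_eq_id[OF xG] dvd_trans by (simp add: torsion_def) blast
    qed
    then have "subgroup K (G\<lparr>carrier := torsion G d\<rparr>)"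
      using K(1) subgroup_torsion subgroup_incl by blast
    from group.lagrange[OF TG this] show ?thesis
      using K(2) by (auto simp: order_def intro: dvdI[OF sym] simp: mult.commute)
  qed
  then have "multiplicity p d \<le> multiplicity p (card (torsion G d))" if "prime p" for p
    using that T0 by (metis multiplicity_dvd multiplicity_geI not_prime_unit)
  then show ?thesis using d0 by (intro multiplicity_le_imp_dvd) auto
qed

text \<open>Multiplication is a bijection from pairs of x-torsion and y-torsion elements: the two
  subgroups meet trivially, and Bezout coefficients split every element.\<close>

lemma (in comm_group) card_torsion_mult:
  assumes xy: "coprime x y"
  shows "card (torsion G (x * y)) = card (torsion G x) * card (torsion G y)"
proof -
  have "bij_betw (\<lambda>(a, b). a \<otimes> b) (torsion G x \<times> torsion G y) (torsion G (x * y))"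
    unfolding bij_betw_def
  proof
    show "inj_on (\<lambda>(a, b). a \<otimes> b) (torsion G x \<times> torsion G y)"
    proof (rule inj_onI, clarify)
      fix a b a' b'
      assume ab: "a \<in> torsion G x" "b \<in> torsion G y" "a' \<in> torsion G x" "b' \<in> torsion G y"
        and eq: "a \<otimes> b = a' \<otimes> b'"
      then have c: "a \<in> carrier G" "b \<in> carrier G" "a' \<in> carrier G" "b' \<in> carrier G"
        by (auto simp: torsion_def)
      have "inv a' \<otimes> a = b' \<otimes> inv b"
        using eq c by (metis inv_closed inv_solve_left inv_solve_right m_assoc m_closed)
      moreover have "inv a' \<otimes> a \<in> torsion G x" "b' \<otimes> inv b \<in> torsion G y"
        using ab subgroup_torsion by (simp_all add: subgroup.m_closed subgroup.m_inv_closed)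
      ultimately have "ord (inv a' \<otimes> a) dvd x" "ord (inv a' \<otimes> a) dvd y" "inv a' \<otimes> a \<in> carrier G"
        by (auto simp: torsion_def pow_eq_id)
      then have "ord (inv a' \<otimes> a) = 1" using xy by (metis coprime_common_divisor_nat)
      then have *: "inv a' \<otimes> a = \<one>" using c by (metis ord_eq_1 inv_closed m_closed)
      then have "a = a'" using c by (metis inv_closed inv_equality inv_inv m_comm)
      then show "a = a' \<and> b = b'" using eq c by simp
    qed
    show "(\<lambda>(a, b). a \<otimes> b) ` (torsion G x \<times> torsion G y) = torsion G (x * y)"
    proof (intro equalityI subsetI)
      fix z assume "z \<in> (\<lambda>(a, b). a \<otimes> b) ` (torsion G x \<times> torsion G y)"
      then obtain a b where ab: "z = a \<otimes> b" "a \<in> torsion G x" "b \<in> torsion G y" by auto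
      then have c: "a \<in> carrier G" "b \<in> carrier G" by (auto simp: torsion_def)
      have "a [^] (x * y) = \<one>" "b [^] (x * y) = \<one>"
        using ab by (auto simp: torsion_def pow_eq_id)
      then show "z \<in> torsion G (x * y)"
        using ab(1) c by (simp add: torsion_def pow_mult_distrib m_comm)
    next
      fix z assume "z \<in> torsion G (x * y)"
      then have z: "z \<in> carrier G" "ord z dvd x * y" by (auto simp: torsion_def pow_eq_id)
      \<comment> \<open>z is the product of z ^ (v * y), killed by x, and z ^ (u * x), killed by
        y.\<close>
      have "\<exists>u v. u * int x + v * int y = 1"
        using xy bezout_int[of "int x" "int y"] by (simp add: coprime_iff_gcd_eq_1)
      then obtain u v :: int where uv: "u * int x + v * int y = 1" by blast
      have "int (ord z) dvd int x * int y" using z(2) by (simp flip: of_nat_mult)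
      then have "int (ord z) dvd v * int y * int x" "int (ord z) dvd u * int x * int y"
        by (simp_all add: mult.assoc mult.commute[of "int y"])
      then have "z [^] (v * int y * int x) = \<one>" "z [^] (u * int x * int y) = \<one>"
        by (simp_all add: int_pow_eq_id z(1))
      then have "(z [^] (v * int y)) [^] x = \<one>" "(z [^] (u * int x)) [^] y = \<one>"
        using int_pow_pow[OF z(1), symmetric] by (simp_all add: int_pow_int)
      then have "z [^] (v * int y) \<in> torsion G x" "z [^] (u * int x) \<in> torsion G y"
        using z by (auto simp: torsion_def)
      moreover have "z [^] (v * int y) \<otimes> z [^] (u * int x) = z"
        using z uv by (simp add: int_pow_mult[symmetric] add.commute)
      ultimately show "z \<in> (\<lambda>(a, b). a \<otimes> b) ` (torsion G x \<times> torsion G y)"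
        by (metis (no_types, lifting) SigmaI image_eqI case_prod_conv)
    qed
  qed
  then show ?thesis by (metis bij_betw_same_card card_cartesian_product)
qed

lemma (in comm_group) order_profile_ord:
  assumes fin: "finite (carrier G)"
  shows "order_profile (order G) (\<lambda>e. card {x \<in> carrier G. group.ord G x = e})"
proof -
  have n0: "order G > 0" using fin by (simp add: order_gt_0_iff_finite)
  have pos: "d > 0" if "d dvd order G" for d using that n0 by (auto intro: gr0I)
  note card_torsion_eq_sum[OF fin pos, symmetric, simp]
  have "torsion G (order G) = carrier G" by (auto simp: torsion_def pow_order_eq_1)
  then show ?thesis
    unfolding order_profile_def using n0 dvd_card_torsion[OF fin] card_torsion_mult
    by (auto simp: order_def dest: dvd_mult_left dvd_mult_right)
qed

subsection \<open>Characters\<close>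

definition nat_multiple :: "nat \<Rightarrow> 'g::ab_group_add \<Rightarrow> 'g" where
  "nat_multiple k x = (\<Sum>i<k. x)"

lemma nat_multiple_simps [simp]:
  "nat_multiple 0 x = 0" "nat_multiple (Suc k) x = nat_multiple k x + x"
  by (simp_all add: nat_multiple_def)

lemma nat_multiple_add: "nat_multiple (j + k) x = nat_multiple j x + nat_multiple k x"
  by (induction k) (simp_all add: ac_simps)

lemma nat_multiple_mult: "nat_multiple (j * k) x = nat_multiple j (nat_multiple k x)"
  by (induction j) (simp_all add: nat_multiple_add ac_simps)

section \<open>Subgroups and the extension of their characters\<close>

definition additive_subgroup_of :: "'g::ab_group_add set \<Rightarrow> bool" where
  "additive_subgroup_of A \<longleftrightarrow> 0 \<in> A \<and> (\<forall>x\<in>A. \<forall>y\<in>A. x + y \<in> A) \<and> (\<forall>x\<in>A. - x \<in> A)"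

lemma
  assumes "additive_subgroup_of A"
  shows additive_subgroup_of_0: "0 \<in> A"
    and additive_subgroup_of_add: "x \<in> A \<Longrightarrow> y \<in> A \<Longrightarrow> x + y \<in> A"
    and additive_subgroup_of_uminus: "x \<in> A \<Longrightarrow> - x \<in> A"
    and additive_subgroup_of_diff: "x \<in> A \<Longrightarrow> y \<in> A \<Longrightarrow> x - y \<in> A"
    and additive_subgroup_of_nat_multiple: "x \<in> A \<Longrightarrow> nat_multiple k x \<in> A"
proof -
  show 0: "0 \<in> A" and add: "\<And>x y. x \<in> A \<Longrightarrow> y \<in> A \<Longrightarrow> x + y \<in> A"
    and uminus: "\<And>x. x \<in> A \<Longrightarrow> - x \<in> A"
    using assms by (auto simp: additive_subgroup_of_def)
  show "x \<in> A \<Longrightarrow> y \<in> A \<Longrightarrow> x - y \<in> A"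
    using add[of x "- y"] uminus[of y] by simp
  show "x \<in> A \<Longrightarrow> nat_multiple k x \<in> A"
    by (induction k) (auto simp: 0 add)
qed

text \<open>Values outside A are arbitrary, so that a character of a subgroup can be a total
  function. The condition at 0 excludes the zero function.\<close>

definition character_on :: "'g::ab_group_add set \<Rightarrow> ('g \<Rightarrow> complex) \<Rightarrow> bool" where
  "character_on A f \<longleftrightarrow> f 0 = 1 \<and> (\<forall>x\<in>A. \<forall>y\<in>A. f (x + y) = f x * f y)"

lemma
  assumes "character_on A f"
  shows character_on_0: "f 0 = 1"
    and character_on_add: "x \<in> A \<Longrightarrow> y \<in> A \<Longrightarrow> f (x + y) = f x * f y"
  using assms by (auto simp: character_on_def)

lemma character_on_nonzero:
  assumes "additive_subgroup_of A" "character_on A f" "x \<in> A"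
  shows "f x \<noteq> 0"
  using character_on_add[OF assms(2,3), of "- x"] character_on_0[OF assms(2)]
    additive_subgroup_of_uminus[OF assms(1,3)] by auto

lemma character_on_nat_multiple:
  assumes "additive_subgroup_of A" "character_on A f" "x \<in> A"
  shows "f (nat_multiple k x) = f x ^ k"
  by (induction k) (use assms in \<open>auto simp: character_on_0 character_on_add additive_subgroup_of_nat_multiple\<close>)

lemma ex_nat_multiple_eq_0:
  fixes x :: "'g::{finite, ab_group_add}"
  obtains k where "k > 0" "nat_multiple k x = 0"
proof -
  have "\<not> inj (\<lambda>k. nat_multiple k x)"
    using finite_imageD[of "\<lambda>k. nat_multiple k x" UNIV] by (metis finite infinite_UNIV_nat)
  then obtain i j where "i < j" "nat_multiple i x = nat_multiple j x"
    unfolding inj_def by (metis linorder_neqE_nat)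
  then have "j - i > 0" "nat_multiple (j - i) x = 0"
    using nat_multiple_add[of i "j - i" x] by auto
  then show ?thesis by (rule that)
qed

text \<open>Let r be the least positive number with r x in A and \<zeta> an r-th root of f (r x);
  then f' (a + k x) = f a * \<zeta> ^ k is well defined. Since x is not in A, r >= 2, so some root
  differs from 1; this later makes characters separate points.\<close>

lemma character_on_extend_one:
  fixes x :: "'g::{finite, ab_group_add}"
  assumes A: "additive_subgroup_of A" and f: "character_on A f" and x: "x \<notin> A"
  obtains A' f' where "additive_subgroup_of A'" "character_on A' f'" "insert x A \<subseteq> A'"
    "\<And>a. a \<in> A \<Longrightarrow> f' a = f a" "f' x \<noteq> 1"
proof -
  note A0 = additive_subgroup_of_0[OF A] and Aadd = additive_subgroup_of_add[OF A]
    and Adiff = additive_subgroup_of_diff[OF A] and Auminus = additive_subgroup_of_uminus[OF A]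
  define r where "r = (LEAST k. k > 0 \<and> nat_multiple k x \<in> A)"
  have "\<exists>k. k > 0 \<and> nat_multiple k x \<in> A" using ex_nat_multiple_eq_0 A0 by metis
  then have "r > 0 \<and> nat_multiple r x \<in> A" unfolding r_def by (rule LeastI_ex)
  then have r: "r > 0" "nat_multiple r x \<in> A" by auto
  have r_least: "r \<le> k" if "k > 0" "nat_multiple k x \<in> A" for k
    unfolding r_def using that by (intro Least_le) auto
  have r_dvd: "r dvd k" if k: "nat_multiple k x \<in> A" for k
  proof -
    have "nat_multiple k x = nat_multiple (k div r) (nat_multiple r x) + nat_multiple (k mod r) x"
      by (simp flip: nat_multiple_add nat_multiple_mult)
    then have "nat_multiple (k mod r) x = nat_multiple k x - nat_multiple (k div r) (nat_multiple r x)"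
      by simp
    also have "\<dots> \<in> A" using k additive_subgroup_of_nat_multiple[OF A r(2)] by (rule Adiff)
    finally have "\<not> k mod r > 0" using r_least[of "k mod r"] mod_less_divisor[OF r(1), of k] by linarith
    then show ?thesis by auto
  qed
  have "r \<noteq> 1" using r x by auto
  with r have card2: "card {z. z ^ r = f (nat_multiple r x)} \<ge> 2"
    using character_on_nonzero[OF A f r(2)] by (subst card_nth_roots) auto
  have "\<not> {z. z ^ r = f (nat_multiple r x)} \<subseteq> {1}"
  proof
    assume "{z. z ^ r = f (nat_multiple r x)} \<subseteq> {1}"
    then have "card {z. z ^ r = f (nat_multiple r x)} \<le> card {1::complex}" by (intro card_mono) auto
    with card2 show False by simp
  qed
  then obtain \<zeta> where \<zeta>: "\<zeta> ^ r = f (nat_multiple r x)" "\<zeta> \<noteq> 1" by auto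
  \<comment> \<open>Two representations differ by some j x in A, so r divides j and \<zeta> ^ j = f
    (j x).\<close>
  have well_le: "f a * \<zeta> ^ k = f b * \<zeta> ^ l"
    if ab: "a \<in> A" "b \<in> A" "a + nat_multiple k x = b + nat_multiple l x" "k \<le> l" for a b k l
  proof -
    obtain j where j: "l = k + j" using ab(4) le_Suc_ex by blast
    then have aj: "a = b + nat_multiple j x"
      using ab(3) by (simp add: nat_multiple_add ac_simps)
    then have jA: "nat_multiple j x \<in> A" using Adiff[OF ab(1,2)] by simp
    then obtain q where q: "j = q * r" using r_dvd by (metis dvd_def mult.commute)
    have "f (nat_multiple j x) = \<zeta> ^ j"
      unfolding q nat_multiple_mult using r \<zeta>
      by (simp add: character_on_nat_multiple[OF A f] power_mult mult.commute[of q])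
    then show ?thesis
      using character_on_add[OF f ab(2) jA] by (simp add: aj j power_add)
  qed
  have well: "f a * \<zeta> ^ k = f b * \<zeta> ^ l"
    if ab: "a \<in> A" "b \<in> A" "a + nat_multiple k x = b + nat_multiple l x" for a b k l
    using well_le[of a b k l] well_le[of b a l k] ab by (metis nle_le)
  define A' where "A' = {a + nat_multiple k x | a k. a \<in> A}"
  define f' where "f' y = (THE z. \<exists>a k. a \<in> A \<and> y = a + nat_multiple k x \<and> z = f a * \<zeta> ^ k)" for y
  have f': "f' (a + nat_multiple k x) = f a * \<zeta> ^ k" if "a \<in> A" for a k
    unfolding f'_def
  proof (rule the_equality)
    fix z assume "\<exists>b l. b \<in> A \<and> a + nat_multiple k x = b + nat_multiple l x \<and> z = f b * \<zeta> ^ l"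
    then obtain b l where "b \<in> A" "a + nat_multiple k x = b + nat_multiple l x" "z = f b * \<zeta> ^ l" by blast
    then show "z = f a * \<zeta> ^ k" using well[OF \<open>a \<in> A\<close>, of b k l] by simp
  qed (use that in blast)
  show ?thesis
  proof (rule that[of A' f'])
    show "insert x A \<subseteq> A'"
    proof -
      have "x = 0 + nat_multiple 1 x" "\<And>a. a = a + nat_multiple 0 x" by auto
      then show ?thesis using A0 unfolding A'_def by blast
    qed
    show ext: "f' a = f a" if "a \<in> A" for a using f'[OF that, of 0] by simp
    show "f' x \<noteq> 1" using f'[OF A0, of 1] \<zeta> by (simp add: character_on_0[OF f])
    show "character_on A' f'"
      unfolding character_on_def
    proof (intro conjI ballI)
      show "f' 0 = 1" using ext[OF A0] by (simp add: character_on_0[OF f])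
      fix y z assume "y \<in> A'" "z \<in> A'"
      then obtain a k b l where yz: "y = a + nat_multiple k x" "z = b + nat_multiple l x" and ab: "a \<in> A" "b \<in> A"
        by (auto simp: A'_def)
      have "y + z = (a + b) + nat_multiple (k + l) x" by (simp add: yz nat_multiple_add ac_simps)
      then have "f' (y + z) = f (a + b) * \<zeta> ^ (k + l)" using f'[OF Aadd[OF ab]] by metis
      also have "\<dots> = f' y * f' z"
        using f'[OF ab(1)] f'[OF ab(2)] character_on_add[OF f ab] by (simp add: yz power_add)
      finally show "f' (y + z) = f' y * f' z" .
    qed
    show "additive_subgroup_of A'"
      unfolding additive_subgroup_of_def
    proof (intro conjI ballI)
      show "0 \<in> A'" using \<open>insert x A \<subseteq> A'\<close> A0 by blast
      fix y assume "y \<in> A'"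
      then obtain a k where y: "y = a + nat_multiple k x" "a \<in> A" by (auto simp: A'_def)
      \<comment> \<open>Elements of \<open>A'\<close> use natural multiples only, hence - k x is
        written as l x - k (r x), where k (r x) is in A.\<close>
      define l where "l = k * r - k"
      have "k * r = k + l" using r by (simp add: l_def)
      then have "nat_multiple k (nat_multiple r x) = nat_multiple k x + nat_multiple l x"
        by (metis nat_multiple_add nat_multiple_mult)
      then have "- y = (- a - nat_multiple k (nat_multiple r x)) + nat_multiple l x"
        by (simp add: y)
      moreover have "- a - nat_multiple k (nat_multiple r x) \<in> A"
        using Auminus[OF y(2)] additive_subgroup_of_nat_multiple[OF A r(2)] by (rule Adiff)
      ultimately show "- y \<in> A'" unfolding A'_def by blast
      fix z assume "z \<in> A'"
      then obtain b l where z: "z = b + nat_multiple l x" "b \<in> A" by (auto simp: A'_def)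
      have "y + z = (a + b) + nat_multiple (k + l) x" by (simp add: y z nat_multiple_add ac_simps)
      then show "y + z \<in> A'" using Aadd[OF y(2) z(2)] unfolding A'_def by blast
    qed
  qed
qed

lemma character_on_extend:
  fixes A :: "'g::{finite, ab_group_add} set"
  assumes "additive_subgroup_of A" "character_on A f"
  obtains \<xi> where "character_on UNIV \<xi>" "\<And>a. a \<in> A \<Longrightarrow> \<xi> a = f a"
  using assms
proof (induction "card (- A)" arbitrary: A f thesis rule: less_induct)
  case less
  show ?case
  proof (cases "A = UNIV")
    case True
    then show ?thesis using less.prems by blast
  next
    case False
    then obtain x where x: "x \<notin> A" by blast
    obtain A' f' where A': "additive_subgroup_of A'" "character_on A' f'"
      "insert x A \<subseteq> A'" "\<And>a. a \<in> A \<Longrightarrow> f' a = f a" "f' x \<noteq> 1"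
      by (rule character_on_extend_one[OF less.prems(2,3) x]) blast
    have "card (- A') < card (- A)" using A'(3) x by (intro psubset_card_mono) auto
    then obtain \<xi> where "character_on UNIV \<xi>" "\<And>a. a \<in> A' \<Longrightarrow> \<xi> a = f' a"
      using less.hyps[of A' f'] A'(1,2) by blast
    then show ?thesis using less.prems(1) A'(3,4) by (metis insert_subset subset_iff)
  qed
qed

section \<open>The dual group and its orthogonality relations\<close>

definition characters :: "('g::ab_group_add \<Rightarrow> complex) set" where
  "characters = {\<xi>. character_on UNIV \<xi>}"

lemma
  assumes "\<xi> \<in> characters"
  shows characters_0: "\<xi> 0 = 1"
    and characters_add: "\<xi> (x + y) = \<xi> x * \<xi> y"
  using assms by (auto simp: characters_def character_on_def)

text \<open>Extend the trivial character of {0} first past g with a value other than 1, then to the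
  whole group.\<close>

lemma characters_separate:
  fixes g :: "'g::{finite, ab_group_add}"
  assumes "g \<noteq> 0"
  obtains \<xi> where "\<xi> \<in> characters" "\<xi> g \<noteq> 1"
proof -
  have "additive_subgroup_of {0::'g}" "character_on {0::'g} (\<lambda>_. 1)" "g \<notin> {0}"
    using assms by (auto simp: additive_subgroup_of_def character_on_def)
  then obtain A f where A: "additive_subgroup_of A" "character_on A f" "insert g {0} \<subseteq> A" "f g \<noteq> 1"
    by (rule character_on_extend_one)
  from A(1,2) obtain \<xi> where "character_on UNIV \<xi>" "\<And>a. a \<in> A \<Longrightarrow> \<xi> a = f a"
    by (rule character_on_extend) blast
  with A that[of \<xi>] show ?thesis by (auto simp: characters_def)
qed

lemma bij_plus: "bij (\<lambda>x. g + x)" for g :: "'g::ab_group_add"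
  by (rule bij_betw_byWitness[where f' = "\<lambda>x. x - g"]) auto

lemma characters_nonzero: "\<xi> \<in> characters \<Longrightarrow> \<xi> g \<noteq> 0"
  by (metis characters_0 characters_add ab_left_minus mult_zero_right zero_neq_one)

text \<open>Translation by g permutes the group and multiplies the nonzero product of all values by
  \<xi> g ^ n.\<close>

lemma characters_power_card:
  fixes g :: "'g::{finite, ab_group_add}"
  assumes \<xi>: "\<xi> \<in> characters"
  shows "\<xi> g ^ CARD('g) = 1"
proof -
  have "(\<Prod>x\<in>UNIV. \<xi> x) = (\<Prod>x\<in>UNIV. \<xi> (g + x))"
    using prod.reindex_bij_betw[OF bij_plus, of \<xi> g] by simp
  also have "\<dots> = \<xi> g ^ CARD('g) * (\<Prod>x\<in>UNIV. \<xi> x)"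
    using \<xi> by (simp add: characters_add prod.distrib)
  finally show ?thesis using characters_nonzero[OF \<xi>] by simp
qed

lemma finite_characters: "finite (characters :: ('g::{finite, ab_group_add} \<Rightarrow> complex) set)"
proof (rule finite_subset)
  show "characters \<subseteq> (UNIV :: 'g set) \<rightarrow>\<^sub>E {z::complex. z ^ CARD('g) = 1}"
    using characters_power_card by auto
  show "finite ((UNIV :: 'g set) \<rightarrow>\<^sub>E {z::complex. z ^ CARD('g) = 1})"
    by (intro finite_PiE finite_roots_unity) (auto simp: Suc_le_eq)
qed

text \<open>Packaged as a record so that \<open>ord\<close> and the torsion lemmas apply.\<close>

definition character_group :: "('g::ab_group_add \<Rightarrow> complex) monoid" where
  "character_group = \<lparr>carrier = characters, mult = (\<lambda>\<xi> \<psi> x. \<xi> x * \<psi> x), one = (\<lambda>_. 1)\<rparr>"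

lemma carrier_character_group [simp]: "carrier character_group = characters"
  and mult_character_group [simp]: "\<xi> \<otimes>\<^bsub>character_group\<^esub> \<psi> = (\<lambda>x. \<xi> x * \<psi> x)"
  and one_character_group [simp]: "\<one>\<^bsub>character_group\<^esub> = (\<lambda>_. 1)"
  by (simp_all add: character_group_def)

lemma comm_group_character_group: "comm_group (character_group :: ('g::ab_group_add \<Rightarrow> complex) monoid)"
proof (rule comm_groupI)
  fix \<xi> :: "'g \<Rightarrow> complex" assume "\<xi> \<in> carrier character_group"
  then have \<xi>: "\<xi> \<in> characters" by simp
  have "(\<lambda>x. \<xi> (- x)) \<in> characters"
    using characters_add[OF \<xi>, of "- x" "- y" for x y] characters_0[OF \<xi>]
    by (auto simp: characters_def character_on_def)
  moreover have "\<xi> (- x) * \<xi> x = 1" for x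
    using characters_add[OF \<xi>, of "- x" x] characters_0[OF \<xi>] by simp
  ultimately show "\<exists>\<psi>\<in>carrier character_group. \<psi> \<otimes>\<^bsub>character_group\<^esub> \<xi> = \<one>\<^bsub>character_group\<^esub>"
    by (intro bexI[of _ "\<lambda>x. \<xi> (- x)"]) auto
qed (auto simp: characters_def character_on_def)

lemma nat_pow_character_group [simp]: "\<xi> [^]\<^bsub>character_group\<^esub> (k::nat) = (\<lambda>x. \<xi> x ^ k)"
proof (induction k)
  case 0
  interpret comm_group character_group by (rule comm_group_character_group)
  show ?case by simp
next
  case (Suc k)
  interpret comm_group character_group by (rule comm_group_character_group)
  show ?case using Suc by (simp add: mult.commute)
qed

text \<open>Translating by some g with \<xi> g \<noteq> 1 multiplies the sum by \<xi> g without
  changing it.\<close>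

lemma sum_character:
  fixes \<xi> :: "'g::{finite, ab_group_add} \<Rightarrow> complex"
  assumes \<xi>: "\<xi> \<in> characters"
  shows "(\<Sum>g\<in>UNIV. \<xi> g) = (if \<xi> = (\<lambda>_. 1) then of_nat CARD('g) else 0)"
proof (cases "\<xi> = (\<lambda>_. 1)")
  case False
  then obtain g where g: "\<xi> g \<noteq> 1" by auto
  have "(\<Sum>x\<in>UNIV. \<xi> x) = (\<Sum>x\<in>UNIV. \<xi> (g + x))"
    using sum.reindex_bij_betw[OF bij_plus, of \<xi> g] by simp
  also have "\<dots> = \<xi> g * (\<Sum>x\<in>UNIV. \<xi> x)"
    using \<xi> by (simp add: characters_add sum_distrib_left)
  finally show ?thesis using g False by simp
qed simp

text \<open>The dual argument: multiply all characters by one that separates g from 0.\<close>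

lemma sum_characters_apply:
  fixes g :: "'g::{finite, ab_group_add}"
  shows "(\<Sum>\<xi>\<in>characters. \<xi> g) = (if g = 0 then of_nat (card (characters :: ('g \<Rightarrow> complex) set)) else 0)"
proof (cases "g = 0")
  case True
  then show ?thesis by (simp add: characters_0)
next
  case False
  then obtain \<psi> where \<psi>: "\<psi> \<in> characters" "\<psi> g \<noteq> 1" by (rule characters_separate)
  have "bij_betw (\<lambda>\<xi> x. \<psi> x * \<xi> x) characters characters"
    using \<psi>(1) characters_nonzero[OF \<psi>(1)]
    by (intro bij_betw_byWitness[where f' = "\<lambda>\<xi> x. \<xi> x / \<psi> x"])
      (auto simp: characters_def character_on_def)
  from sum.reindex_bij_betw[OF this, of "\<lambda>\<xi>. \<xi> g"]
  have "(\<Sum>\<xi>\<in>characters. \<xi> g) = (\<Sum>\<xi>\<in>characters. \<psi> g * \<xi> g)" by simp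
  also have "\<dots> = \<psi> g * (\<Sum>\<xi>\<in>characters. \<xi> g)" by (simp add: sum_distrib_left)
  finally show ?thesis using \<psi> False by simp
qed

text \<open>The double sum of all \<xi> g gives the number of characters in one order of summation
  and the group order in the other.\<close>

lemma card_characters: "card (characters :: ('g::{finite, ab_group_add} \<Rightarrow> complex) set) = CARD('g)"
proof -
  have 1: "(\<lambda>_. 1) \<in> (characters :: ('g \<Rightarrow> complex) set)" by (simp add: characters_def character_on_def)
  have "of_nat (card (characters :: ('g \<Rightarrow> complex) set)) = (\<Sum>g\<in>UNIV. \<Sum>\<xi>\<in>(characters :: ('g \<Rightarrow> complex) set). \<xi> g)"
    by (simp add: sum_characters_apply)
  also have "\<dots> = (\<Sum>\<xi>\<in>(characters :: ('g \<Rightarrow> complex) set). \<Sum>g\<in>UNIV. \<xi> g)" by (rule sum.swap)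
  also have "\<dots> = (of_nat CARD('g) :: complex)"
    using 1 by (simp add: sum_character finite_characters)
  finally show ?thesis by (simp only: of_nat_eq_iff)
qed

lemma order_character_group: "order (character_group :: ('g::{finite, ab_group_add} \<Rightarrow> complex) monoid) = CARD('g)"
  by (simp add: order_def card_characters)

section \<open>Orders of characters and their values\<close>

definition character_count :: "'g::{finite, ab_group_add} itself \<Rightarrow> nat \<Rightarrow> nat" where
  "character_count _ d = card {\<xi> \<in> (characters :: ('g \<Rightarrow> complex) set). group.ord character_group \<xi> = d}"

lemma order_profile_character_count:
  "order_profile CARD('g) (character_count TYPE('g::{finite, ab_group_add}))"
proof -
  interpret comm_group "character_group :: ('g \<Rightarrow> complex) monoid" by (rule comm_group_character_group)
  show ?thesis
    using order_profile_ord by (simp add: order_character_group finite_characters character_count_def[abs_def])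
qed

text \<open>A character of order d takes exactly the d-th roots of unity as values, each equally
  often, so a product over the group is a power of a product over these roots.\<close>

lemma
  fixes \<xi> :: "'g::{finite, ab_group_add} \<Rightarrow> complex" and P :: "complex \<Rightarrow> 'b::comm_semiring_1"
  assumes \<xi>: "\<xi> \<in> characters"
  defines "d \<equiv> group.ord character_group \<xi>"
  shows ord_character_dvd: "d dvd CARD('g)"
    and prod_character: "(\<Prod>g\<in>UNIV. P (\<xi> g)) = (\<Prod>z | z ^ d = 1. P z) ^ (CARD('g) div d)"
proof -
  interpret comm_group "character_group :: ('g \<Rightarrow> complex) monoid" by (rule comm_group_character_group)
  have ord: "(\<lambda>x. \<xi> x ^ k) = (\<lambda>_. 1) \<longleftrightarrow> d dvd k" for k
    using pow_eq_id[of \<xi> k] \<xi> by (simp add: d_def)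
  show dvd: "d dvd CARD('g)" using ord[of "CARD('g)"] characters_power_card[OF \<xi>] by auto
  then have d0: "d > 0" by (auto intro: gr0I)
  have range: "range \<xi> = {z. z ^ d = 1}"
  proof (rule card_subset_eq)
    show "finite {z::complex. z ^ d = 1}" using d0 by (intro finite_roots_unity) auto
    show sub: "range \<xi> \<subseteq> {z. z ^ d = 1}" using fun_cong[OF iffD2[OF ord dvd_refl]] by auto
    \<comment> \<open>Multiplication by \<xi> g permutes the image. Comparing products over it shows
      that \<xi> to the size of its image is trivial, so that size is a multiple of d.\<close>
    have "\<xi> g ^ card (range \<xi>) = 1" for g
    proof -
      have "bij_betw (\<lambda>z. \<xi> g * z) (range \<xi>) (range \<xi>)"
      proof (rule bij_betw_byWitness[where f' = "\<lambda>z. \<xi> (- g) * z"])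
        have "\<xi> (- g) * \<xi> g = 1" "\<xi> g * \<xi> (- g) = 1"
          using characters_add[OF \<xi>, of "- g" g] characters_add[OF \<xi>, of g "- g"] characters_0[OF \<xi>] by simp_all
        then show "\<forall>a\<in>range \<xi>. \<xi> (- g) * (\<xi> g * a) = a" "\<forall>a\<in>range \<xi>. \<xi> g * (\<xi> (- g) * a) = a"
          by (simp_all flip: mult.assoc)
      qed (auto simp: characters_add[OF \<xi>, symmetric])
      then have "(\<Prod>z\<in>range \<xi>. z) = (\<Prod>z\<in>range \<xi>. \<xi> g * z)" by (simp add: prod.reindex_bij_betw[of _ _ _ "\<lambda>z. z"])
      then have "(\<Prod>z\<in>range \<xi>. z) = \<xi> g ^ card (range \<xi>) * (\<Prod>z\<in>range \<xi>. z)" by (simp add: prod.distrib)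
      then show ?thesis using characters_nonzero[OF \<xi>] by auto
    qed
    then have "d dvd card (range \<xi>)" using ord by auto
    then have "d \<le> card (range \<xi>)" by (intro dvd_imp_le) (auto simp: card_gt_0_iff)
    moreover have "card (range \<xi>) \<le> d"
      using card_mono[OF \<open>finite {z::complex. z ^ d = 1}\<close> sub] card_roots_unity_eq[OF d0] by simp
    ultimately show "card (range \<xi>) = card {z::complex. z ^ d = 1}" using card_roots_unity_eq[OF d0] by linarith
  qed
  define K where "K = card {g. \<xi> g = 1}"
  \<comment> \<open>Fibres over attained values are translates of the kernel.\<close>
  have fibre: "card {g. \<xi> g = z} = K" if "z ^ d = 1" for z
  proof -
    have "z \<in> range \<xi>" using that by (simp add: range)
    then obtain h where h: "z = \<xi> h" by (rule rangeE)
    have "bij_betw (\<lambda>g. h + g) {g. \<xi> g = 1} {g. \<xi> g = z}"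
    proof (rule bij_betw_byWitness[where f' = "\<lambda>g. g - h"])
      have "\<xi> (g - h) = 1" if "\<xi> g = \<xi> h" for g
        using characters_add[OF \<xi>, of "g - h" h] that characters_nonzero[OF \<xi>, of h] by simp
      then show "(\<lambda>g. g - h) ` {g. \<xi> g = z} \<subseteq> {g. \<xi> g = 1}" by (auto simp: h)
    qed (auto simp: h characters_add[OF \<xi>])
    then show ?thesis unfolding K_def by (rule bij_betw_same_card[symmetric])
  qed
  have prod_K: "(\<Prod>g\<in>UNIV. Q (\<xi> g)) = (\<Prod>z | z ^ d = 1. Q z ^ K)" for Q :: "complex \<Rightarrow> 'b"
    using prod.image_gen[of UNIV "\<lambda>g. Q (\<xi> g)" \<xi>] fibre by (simp add: range)
  have "CARD('g) = (\<Sum>z\<in>range \<xi>. card {g. \<xi> g = z})"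
    using sum.image_gen[of UNIV "\<lambda>_. 1::nat" \<xi>] by simp
  also have "\<dots> = d * K" using fibre card_roots_unity_eq[OF d0] by (simp add: range)
  finally have "CARD('g) div d = K" using d0 by simp
  then show "(\<Prod>g\<in>UNIV. P (\<xi> g)) = (\<Prod>z | z ^ d = 1. P z) ^ (CARD('g) div d)"
    using prod_K[of P] by (simp add: prod_power_distrib[symmetric])
qed

subsection \<open>Zero-sum multisets\<close>

text \<open>Both sides are polynomials of degree at most d in y that agree at 0 and at the d roots
  of unity, one point too many for a nonzero difference.\<close>

lemma prod_one_minus_roots_unity:
  fixes y :: complex
  assumes d: "d > 0"
  shows "(\<Prod>z | z ^ d = 1. 1 - z * y) = 1 - y ^ d"
proof -
  define R where "R = {z::complex. z ^ d = 1}"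
  have R: "finite R" "card R = d" "0 \<notin> R"
    using d by (auto simp: R_def finite_roots_unity card_roots_unity_eq Suc_le_eq zero_power)
  define p where "p = (\<Prod>z\<in>R. [:1, - z:])"
  define q where "q = 1 - [:0, 1::complex:] ^ d"
  have pq0: "p - q = 0"
  proof (rule ccontr)
    assume nz: "p - q \<noteq> 0"
    have "Polynomial.degree p \<le> (\<Sum>z\<in>R. Polynomial.degree [:1, - z:])"
      unfolding p_def using degree_prod_sum_le[OF R(1), of "\<lambda>z. [:1, - z:]"] by (simp add: o_def)
    also have "\<dots> \<le> (\<Sum>z\<in>R. 1)" by (intro sum_mono) simp
    finally have "Polynomial.degree p \<le> d" using R by simp
    moreover have "Polynomial.degree q \<le> d"
      unfolding q_def using degree_power_le[of "[:0, 1::complex:]" d] by (intro degree_diff_le) auto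
    ultimately have "Polynomial.degree (p - q) \<le> d" by (intro degree_diff_le)
    moreover have "insert 0 R \<subseteq> {x. poly (p - q) x = 0}"
    proof -
      have "poly (p - q) x = 0" if x: "x \<in> R" for x
      proof -
        have "x \<noteq> 0" "inverse x \<in> R" using x R(3) by (auto simp: R_def power_inverse)
        then have "poly p x = 0" using R(1) by (auto simp: p_def poly_prod intro!: bexI[of _ "inverse x"])
        moreover have "poly q x = 0" using x by (simp add: q_def R_def)
        ultimately show ?thesis by simp
      qed
      moreover have "poly (p - q) 0 = 0" using d by (simp add: p_def q_def poly_prod)
      ultimately show ?thesis by auto
    qed
    then have "card (insert 0 R) \<le> card {x. poly (p - q) x = 0}"
      using poly_roots_finite[OF nz] by (intro card_mono) auto
    ultimately show False using card_poly_roots_bound[OF nz] R by simp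
  qed
  then have "poly p y = poly q y" by simp
  then show ?thesis by (simp add: p_def q_def poly_prod R_def mult.commute)
qed

lemma prod_one_minus_roots_unity_fps:
  assumes d: "d > 0"
  shows "(\<Prod>z | z ^ d = 1. 1 - fps_const (z * w) * fps_X) = 1 - fps_const (w ^ d :: complex) * fps_X ^ d"
proof -
  have "(\<Prod>z | z ^ d = 1. [:1, - (z * w):]) = 1 - Polynomial.smult (w ^ d) ([:0, 1::complex:] ^ d)"
  proof -
    have "poly (\<Prod>z | z ^ d = 1. [:1, - (z * w):]) y = poly (1 - Polynomial.smult (w ^ d) ([:0, 1::complex:] ^ d)) y" for y
      using prod_one_minus_roots_unity[OF d, of "w * y"]
      by (simp add: poly_prod power_mult_distrib mult_ac)
    then show ?thesis by (intro poly_eq_poly_eq_iff[THEN iffD1] ext)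
  qed
  then have "fps_of_poly (\<Prod>z | z ^ d = 1. [:1, - (z * w):]) = fps_of_poly (1 - Polynomial.smult (w ^ d) ([:0, 1::complex:] ^ d))"
    by (rule arg_cong)
  then show ?thesis
    by (simp add: fps_of_poly_prod fps_of_poly_pCons fps_of_poly_diff fps_of_poly_smult fps_of_poly_power flip: fps_const_neg)
qed

text \<open>This is \<open>1 / N\<close> times the coefficient of \<open>X ^ M\<close> in \<open>((1 - v X) / (1 - X)) ^ N\<close>, written so
  that its symmetry in \<open>N\<close> and \<open>M\<close> is visible.\<close>

definition balanced_coeff :: "complex \<Rightarrow> nat \<Rightarrow> nat \<Rightarrow> complex" where
  "balanced_coeff v N M =
     (\<Sum>j\<le>min N M. (- v) ^ j * fact (N + M - j - 1) / (fact j * fact (N - j) * fact (M - j)))"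

lemma balanced_coeff_commute: "balanced_coeff v N M = balanced_coeff v M N"
  by (simp add: balanced_coeff_def add.commute min.commute mult_ac)

lemma balanced_coeff_0:
  assumes "N > 0"
  shows "balanced_coeff 0 N M = of_nat ((N + M) choose M) / of_nat (N + M)"
proof -
  have "balanced_coeff 0 N M = (\<Sum>j\<in>{0}. (- 0) ^ j * fact (N + M - j - 1) / (fact j * fact (N - j) * fact (M - j)))"
    unfolding balanced_coeff_def by (intro sum.mono_neutral_right) auto
  then have "balanced_coeff 0 N M = fact (N + M - 1) / (fact N * fact M)" by simp
  moreover have "fact (N + M) = of_nat (N + M) * (fact (N + M - 1) :: complex)"
    using assms by (subst fact_reduce) auto
  ultimately show ?thesis using assms by (simp add: binomial_fact field_simps del: of_nat_add)
qed

lemma fps_nth_one_minus_power: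
  "fps_nth ((1 - fps_const (v::complex) * fps_X) ^ N) i = of_nat (N choose i) * (- v) ^ i"
proof (cases "v = 0")
  case True
  then show ?thesis by (cases i) auto
next
  case False
  show ?thesis
    unfolding one_minus_const_fps_X_power[OF False] fps_const_neg[symmetric] binomial_gbinomial
    by (simp only: fps_const_neg fps_nth_compose_linear fps_binomial_nth) (rule mult.commute)
qed

text \<open>In the convolution of the two binomial series the factor N! / (N - 1)! = N splits off;
  what remains is symmetric in N and M.\<close>

lemma fps_nth_balanced_coeff:
  assumes N: "N > 0"
  shows "fps_nth ((1 - fps_const v * fps_X) ^ N * inverse ((1 - fps_X) ^ N)) M = of_nat N * balanced_coeff v N M"
proof -
  have inv: "fps_nth (inverse ((1 - fps_X) ^ N)) k = (of_nat ((N + k - 1) choose k) :: complex)" for k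
    using one_minus_const_fps_X_neg_power'[OF N, of "1::complex"] by simp
  have coeff_term: "of_nat (N choose j) * of_nat ((N + (M - j) - 1) choose (M - j)) =
      of_nat N * (fact (N + M - j - 1) / (fact j * fact (N - j) * fact (M - j)) :: complex)"
    if j: "j \<le> N" "j \<le> M" for j
  proof -
    have "(fact N :: complex) = of_nat N * fact (N - 1)" using N by (simp add: fact_reduce)
    moreover have "N + (M - j) - 1 = N + M - j - 1" "N + M - j - 1 - (M - j) = N - 1" "M - j \<le> N + M - j - 1"
      using j N by auto
    ultimately show ?thesis using j by (simp add: binomial_fact field_simps)
  qed
  have "fps_nth ((1 - fps_const v * fps_X) ^ N * inverse ((1 - fps_X) ^ N)) M
      = (\<Sum>j=0..M. of_nat (N choose j) * (- v) ^ j * of_nat ((N + (M - j) - 1) choose (M - j)))"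
    by (simp add: fps_mult_nth fps_nth_one_minus_power inv)
  also have "\<dots> = (\<Sum>j\<le>min N M. of_nat (N choose j) * (- v) ^ j * of_nat ((N + (M - j) - 1) choose (M - j)))"
    by (intro sum.mono_neutral_right) auto
  also have "\<dots> = (\<Sum>j\<le>min N M. (- v) ^ j * (of_nat (N choose j) * of_nat ((N + (M - j) - 1) choose (M - j))))"
    by (simp only: mult_ac)
  also have "\<dots> = (\<Sum>j\<le>min N M. (- v) ^ j * (of_nat N * (fact (N + M - j - 1) / (fact j * fact (N - j) * fact (M - j)))))"
    using coeff_term by (intro sum.cong refl) simp
  also have "\<dots> = of_nat N * balanced_coeff v N M"
    by (simp add: balanced_coeff_def sum_distrib_left mult_ac)
  finally show ?thesis .
qed

section \<open>Multisets weighted by support size and a character\<close>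

lemma character_sum_mset:
  assumes "\<xi> \<in> characters"
  shows "\<xi> (\<Sum>\<^sub># X) = (\<Prod>x\<in>#X. \<xi> x)"
  by (induction X) (auto simp: characters_0[OF assms] characters_add[OF assms])

text \<open>The sum is a coefficient of a product of power series over g, and by
  \<open>prod_character\<close> this product depends on \<xi> only through d. It is a series in X ^
  d, whence the condition on m.\<close>

lemma sum_multisets_character:
  fixes \<xi> :: "'g::{finite, ab_group_add} \<Rightarrow> complex"
  assumes \<xi>: "\<xi> \<in> characters" and m: "m > 0"
  defines "d \<equiv> group.ord character_group \<xi>"
  shows "(\<Sum>X | size X = m. u ^ card (set_mset X) * \<xi> (\<Sum>\<^sub># X)) =
    (if d dvd m then of_nat (CARD('g) div d) * balanced_coeff ((1 - u) ^ d) (CARD('g) div d) (m div d) else 0)"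
proof -
  \<comment> \<open>Multiplicity 0 has weight 1 and every positive one carries a single u, so u
    records the support: F g = (1 - (1 - u) \<xi> g X) / (1 - \<xi> g X).\<close>
  define F where "F g = Abs_fps (\<lambda>i. if i = 0 then 1 else u * \<xi> g ^ i)" for g
  define K where "K = CARD('g) div d"
  define B where "B = (1 - fps_const ((1 - u) ^ d) * fps_X) ^ K * inverse ((1 - fps_X :: complex fps) ^ K)"
  have dn: "d dvd CARD('g)" unfolding d_def by (rule ord_character_dvd[OF \<xi>])
  then have d0: "d > 0" by (auto intro: gr0I)
  have K0: "K > 0" using dn d0 by (auto simp: K_def dvd_imp_le div_greater_zero_iff)
  have "(\<Sum>X | size X = m. u ^ card (set_mset X) * \<xi> (\<Sum>\<^sub># X)) =
        (\<Sum>X | size X = m. \<Prod>g\<in>UNIV. fps_nth (F g) (count X g))"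
  proof (intro sum.cong refl)
    fix X :: "'g multiset"
    have "(\<Prod>g\<in>UNIV. fps_nth (F g) (count X g)) = (\<Prod>g\<in>set_mset X. fps_nth (F g) (count X g))"
      by (intro prod.mono_neutral_right) (auto simp: F_def not_in_iff)
    also have "\<dots> = (\<Prod>g\<in>set_mset X. u * \<xi> g ^ count X g)"
      by (intro prod.cong) (auto simp: F_def count_eq_zero_iff)
    also have "\<dots> = u ^ card (set_mset X) * \<xi> (\<Sum>\<^sub># X)"
      by (simp add: prod.distrib character_sum_mset[OF \<xi>] image_prod_mset_multiplicity)
    finally show "u ^ card (set_mset X) * \<xi> (\<Sum>\<^sub># X) = (\<Prod>g\<in>UNIV. fps_nth (F g) (count X g))" by simp
  qed
  also have "\<dots> = fps_nth (\<Prod>g\<in>UNIV. F g) m"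
    by (subst fps_prod_nth') (auto simp: multisets_of_size_def)
  \<comment> \<open>Both sides are compared after multiplication by (1 - X ^ d) ^ K, which can be
    cancelled because its constant coefficient is 1.\<close>
  also have "(\<Prod>g\<in>UNIV. F g) = B oo (fps_X ^ d)"
  proof -
    have "F g * (1 - fps_const (\<xi> g) * fps_X) = 1 - fps_const (\<xi> g * (1 - u)) * fps_X" for g
    proof (rule fps_ext)
      fix k
      have "F g * (1 - fps_const (\<xi> g) * fps_X) = F g - fps_const (\<xi> g) * (F g * fps_X)"
        by (simp add: algebra_simps)
      moreover have "fps_nth (F g - fps_const (\<xi> g) * (F g * fps_X)) k = fps_nth (1 - fps_const (\<xi> g * (1 - u)) * fps_X) k"
      proof (cases k)
        case (Suc j)
        then show ?thesis by (cases j) (simp_all add: F_def algebra_simps)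
      qed (simp add: F_def)
      ultimately show "fps_nth (F g * (1 - fps_const (\<xi> g) * fps_X)) k = fps_nth (1 - fps_const (\<xi> g * (1 - u)) * fps_X) k"
        by simp
    qed
    then have "(\<Prod>g\<in>UNIV. F g) * (\<Prod>g\<in>UNIV. 1 - fps_const (\<xi> g) * fps_X)
        = (\<Prod>g\<in>UNIV. 1 - fps_const (\<xi> g * (1 - u)) * fps_X)"
      by (simp flip: prod.distrib)
    moreover have "(\<Prod>g\<in>UNIV. 1 - fps_const (\<xi> g) * fps_X) = (1 - fps_X ^ d) ^ K"
      using prod_character[OF \<xi>, of "\<lambda>z. 1 - fps_const z * fps_X"] prod_one_minus_roots_unity_fps[OF d0, of 1]
      by (simp add: d_def K_def)
    moreover have "(\<Prod>g\<in>UNIV. 1 - fps_const (\<xi> g * (1 - u)) * fps_X) = (1 - fps_const ((1 - u) ^ d) * fps_X ^ d) ^ K"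
      using prod_character[OF \<xi>, of "\<lambda>z. 1 - fps_const (z * (1 - u)) * fps_X"]
        prod_one_minus_roots_unity_fps[OF d0, of "1 - u"]
      by (simp add: d_def K_def)
    ultimately have 1: "(\<Prod>g\<in>UNIV. F g) * (1 - fps_X ^ d) ^ K = (1 - fps_const ((1 - u) ^ d) * fps_X ^ d) ^ K"
      by simp
    have X0: "fps_nth (fps_X ^ d :: complex fps) 0 = 0" using d0 by simp
    have "B * (1 - fps_X) ^ K = (1 - fps_const ((1 - u) ^ d) * fps_X) ^ K"
      by (simp add: B_def mult.assoc inverse_mult_eq_1)
    then have "(B * (1 - fps_X) ^ K) oo (fps_X ^ d) = (1 - fps_const ((1 - u) ^ d) * fps_X) ^ K oo (fps_X ^ d)"
      by simp
    then have 2: "(B oo (fps_X ^ d)) * (1 - fps_X ^ d) ^ K = (1 - fps_const ((1 - u) ^ d) * fps_X ^ d) ^ K"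
      by (simp add: fps_compose_mult_distrib[OF X0] fps_compose_power[OF X0, symmetric] fps_compose_sub_distrib
          X0 del: fps_X_power_nth)
    have "fps_nth ((1 - fps_X ^ d :: complex fps) ^ K) 0 = 1" using d0 by (simp add: fps_power_zeroth zero_power)
    then have "(1 - fps_X ^ d :: complex fps) ^ K \<noteq> 0" by (metis fps_zero_nth zero_neq_one)
    then show ?thesis using 1 2 by (metis mult_cancel_right)
  qed
  also have "fps_nth \<dots> m = (if d dvd m then fps_nth B (m div d) else 0)"
    by (rule fps_nth_compose_X_power)
  also have "fps_nth B (m div d) = of_nat K * balanced_coeff ((1 - u) ^ d) K (m div d)"
    unfolding B_def by (rule fps_nth_balanced_coeff[OF K0])
  finally show ?thesis by (simp add: K_def)
qed

lemma finite_multisets_size_eq: "finite {X :: 'a::finite multiset. size X = m}"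
  using finite_multisets_of_size[of "UNIV :: 'a set" m] by (simp add: multisets_of_size_def)

text \<open>Averaging over all characters singles out the multisets with sum 0. The factor n / d
  divided by n becomes 1 / d, so apart from the character counts every summand is symmetric in n and
  m.\<close>

lemma zero_sum_support_polynomial:
  fixes u :: complex
  assumes m: "m > 0"
  shows "(\<Sum>X | size X = m \<and> \<Sum>\<^sub># X = (0::'g::{finite, ab_group_add}). u ^ card (set_mset X)) =
    (\<Sum>d | d dvd CARD('g) \<and> d dvd m. of_nat (character_count TYPE('g) d) / of_nat d *
       balanced_coeff ((1 - u) ^ d) (CARD('g) div d) (m div d))"
proof -
  let ?C = "characters :: ('g \<Rightarrow> complex) set"
  define n where "n = CARD('g)"
  have n0: "n > 0" by (simp add: n_def)
  define f where "f d = (if d dvd m then of_nat (n div d) * balanced_coeff ((1 - u) ^ d) (n div d) (m div d) else 0)" for d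
  have "of_nat n * (\<Sum>X | size X = m \<and> \<Sum>\<^sub># X = (0::'g). u ^ card (set_mset X))
      = (\<Sum>X | size X = m \<and> \<Sum>\<^sub># X = (0::'g). u ^ card (set_mset X) * of_nat n)"
    by (simp add: sum_distrib_left mult.commute)
  also have "\<dots> = (\<Sum>X | size X = m. u ^ card (set_mset X) * (\<Sum>\<xi>\<in>?C. \<xi> (\<Sum>\<^sub># X)))"
    by (intro sum.mono_neutral_cong_left)
      (auto simp: finite_multisets_size_eq sum_characters_apply card_characters n_def)
  also have "\<dots> = (\<Sum>\<xi>\<in>?C. \<Sum>X | size X = m. u ^ card (set_mset X) * \<xi> (\<Sum>\<^sub># X))"
    by (subst sum.swap) (simp add: sum_distrib_left)
  also have "\<dots> = (\<Sum>\<xi>\<in>?C. f (group.ord character_group \<xi>))"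
    using m by (intro sum.cong refl) (simp add: sum_multisets_character f_def n_def)
  also have "\<dots> = (\<Sum>d | d dvd n. \<Sum>\<xi>\<in>{\<xi> \<in> ?C. group.ord character_group \<xi> = d}. f (group.ord character_group \<xi>))"
    using n0 by (intro sum.group[symmetric]) (auto simp: finite_characters ord_character_dvd n_def)
  also have "\<dots> = (\<Sum>d | d dvd n. of_nat (character_count TYPE('g) d) * f d)"
    by (intro sum.cong refl) (simp add: character_count_def)
  also have "\<dots> = (\<Sum>d | d dvd n \<and> d dvd m. of_nat (character_count TYPE('g) d) * f d)"
    using n0 by (intro sum.mono_neutral_right) (auto simp: f_def)
  also have "\<dots> = (\<Sum>d | d dvd n \<and> d dvd m. of_nat n * (of_nat (character_count TYPE('g) d) / of_nat d *
       balanced_coeff ((1 - u) ^ d) (n div d) (m div d)))"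
  proof (intro sum.cong refl)
    fix d assume d: "d \<in> {d. d dvd n \<and> d dvd m}"
    then have "d > 0" using n0 by (auto intro: gr0I)
    moreover have "n = n div d * d" using d by simp
    then have "of_nat n = (of_nat (n div d) * of_nat d :: complex)" by (metis of_nat_mult)
    ultimately show "of_nat (character_count TYPE('g) d) * f d = of_nat n * (of_nat (character_count TYPE('g) d) / of_nat d *
       balanced_coeff ((1 - u) ^ d) (n div d) (m div d))"
      using d by (simp add: f_def)
  qed
  also have "\<dots> = of_nat n * (\<Sum>d | d dvd n \<and> d dvd m. of_nat (character_count TYPE('g) d) / of_nat d *
       balanced_coeff ((1 - u) ^ d) (n div d) (m div d))"
    by (rule sum_distrib_left[symmetric])
  finally show ?thesis using n0 by (simp add: n_def)
qed

text \<open>The case u = 1. There \<open>balanced_coeff\<close> has denominator n / d + m / d, which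
  times d is n + m for every d; clearing it leaves plain binomials.\<close>

lemma card_zero_sum_multisets:
  assumes m: "m > 0"
  shows "real (CARD('g) + m) * real (card {X. size X = m \<and> \<Sum>\<^sub># X = (0::'g::{finite, ab_group_add})}) =
    (\<Sum>d | d dvd CARD('g) \<and> d dvd m. real (character_count TYPE('g) d) *
       real ((CARD('g) div d + m div d) choose (m div d)))"
proof -
  define n where "n = CARD('g)"
  have n0: "n > 0" by (simp add: n_def)
  have "complex_of_real (real (n + m) * real (card {X. size X = m \<and> \<Sum>\<^sub># X = (0::'g)})) =
     of_nat (n + m) * (\<Sum>X | size X = m \<and> \<Sum>\<^sub># X = (0::'g). 1 ^ card (set_mset X))" by simp
  also have "\<dots> = (\<Sum>d | d dvd n \<and> d dvd m. of_nat (n + m) * (of_nat (character_count TYPE('g) d) / of_nat d *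
       balanced_coeff ((1 - 1) ^ d) (n div d) (m div d)))"
    unfolding zero_sum_support_polynomial[OF m] n_def by (simp add: sum_distrib_left)
  also have "\<dots> = (\<Sum>d | d dvd n \<and> d dvd m. of_nat (character_count TYPE('g) d) * of_nat ((n div d + m div d) choose (m div d)))"
  proof (intro sum.cong refl)
    fix d assume d: "d \<in> {d. d dvd n \<and> d dvd m}"
    then have d0: "d > 0" "n div d > 0" using n0 by (auto intro: gr0I simp: div_greater_zero_iff dvd_imp_le)
    have "n + m = d * (n div d + m div d)" using d by (simp add: algebra_simps)
    then have "of_nat (n + m) = (of_nat d * of_nat (n div d + m div d) :: complex)" by (metis of_nat_mult)
    moreover have "(of_nat (n div d + m div d) :: complex) \<noteq> 0" using d0 by (simp only: of_nat_eq_0_iff)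
    ultimately show "of_nat (n + m) * (of_nat (character_count TYPE('g) d) / of_nat d *
         balanced_coeff ((1 - 1) ^ d) (n div d) (m div d)) =
       of_nat (character_count TYPE('g) d) * (of_nat ((n div d + m div d) choose (m div d)) :: complex)"
      using d0 by (simp add: balanced_coeff_0 zero_power del: of_nat_add)
  qed
  also have "\<dots> = complex_of_real (\<Sum>d | d dvd n \<and> d dvd m. real (character_count TYPE('g) d) *
       real ((n div d + m div d) choose (m div d)))" by simp
  finally show ?thesis unfolding of_real_eq_iff n_def .
qed

text \<open>Both sums are polynomials in u whose coefficient at k counts the elements of level
  k.\<close>

lemma card_level_eq_if_sum_power_eq:
  fixes c :: "'a \<Rightarrow> nat" and c' :: "'b \<Rightarrow> nat"
  assumes fin: "finite A" "finite B"
    and eq: "\<And>u::complex. (\<Sum>x\<in>A. u ^ c x) = (\<Sum>x\<in>B. u ^ c' x)"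
  shows "card {x \<in> A. c x = k} = card {x \<in> B. c' x = k}"
proof -
  have "Polynomial.coeff (\<Sum>x\<in>A. [:0, 1::complex:] ^ c x) k = Polynomial.coeff (\<Sum>x\<in>B. [:0, 1::complex:] ^ c' x) k"
    using eq by (intro arg_cong[where f = "\<lambda>p. Polynomial.coeff p k"] poly_eq_poly_eq_iff[THEN iffD1])
      (auto simp: fun_eq_iff poly_sum)
  moreover have "Polynomial.coeff ([:0, 1::complex:] ^ i) k = (if i = k then 1 else 0)" for i
    by (metis coeff_monom monom_altdef smult_1_left)
  ultimately have "(\<Sum>x\<in>A. if c x = k then 1 else 0) = (\<Sum>x\<in>B. if c' x = k then 1 else (0::complex))"
    by (simp add: coeff_sum)
  then have "of_nat (card {x \<in> A. c x = k}) = (of_nat (card {x \<in> B. c' x = k}) :: complex)"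
    using fin by (simp add: sum.If_cases Collect_conj_eq Int_commute)
  then show ?thesis by (simp only: of_nat_eq_iff)
qed

text \<open>Equal totals force equal character counts at the common divisors of n and m; then the
  support polynomials agree at every u.\<close>

lemma card_zero_sum_multisets_support_eq:
  fixes n m k :: nat
  assumes n: "CARD('g::{finite, ab_group_add}) = n" and m: "CARD('h::{finite, ab_group_add}) = m"
    and eq: "card {X. size X = m \<and> \<Sum>\<^sub># X = (0::'g)} = card {X. size X = n \<and> \<Sum>\<^sub># X = (0::'h)}"
  shows "card {X. size X = m \<and> \<Sum>\<^sub># X = (0::'g) \<and> card (set_mset X) = k}
       = card {X. size X = n \<and> \<Sum>\<^sub># X = (0::'h) \<and> card (set_mset X) = k}"
proof -
  have pos: "n > 0" "m > 0" using n m by auto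
  have sym: "(m div e + n div e) choose (n div e) = (n div e + m div e) choose (m div e)" for e
    using binomial_symmetric[of "n div e" "n div e + m div e"] by (simp add: add.commute)
  have chars: "character_count TYPE('g) d = character_count TYPE('h) d" if "d dvd n" "d dvd m" for d
  proof (rule order_profile_eqI[OF _ _ _ that])
    show "order_profile n (character_count TYPE('g))" "order_profile m (character_count TYPE('h))"
      using order_profile_character_count n m by auto
    have "real (n + m) * real (card {X. size X = m \<and> \<Sum>\<^sub># X = (0::'g)})
        = real (m + n) * real (card {X. size X = n \<and> \<Sum>\<^sub># X = (0::'h)})"
      using eq by simp
    then show "(\<Sum>e | e dvd n \<and> e dvd m. real (character_count TYPE('g) e) * real ((n div e + m div e) choose (m div e)))
        = (\<Sum>e | e dvd n \<and> e dvd m. real (character_count TYPE('h) e) * real ((n div e + m div e) choose (m div e)))"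
      using card_zero_sum_multisets[OF pos(2), where 'g = 'g] card_zero_sum_multisets[OF pos(1), where 'g = 'h]
      by (simp add: n m sym conj_commute)
  qed
  have "(\<Sum>X | size X = m \<and> \<Sum>\<^sub># X = (0::'g). u ^ card (set_mset X))
      = (\<Sum>X | size X = n \<and> \<Sum>\<^sub># X = (0::'h). u ^ card (set_mset X))" for u :: complex
    unfolding zero_sum_support_polynomial[OF pos(2), where 'g = 'g]
      zero_sum_support_polynomial[OF pos(1), where 'g = 'h] n m
    by (intro sum.cong) (auto simp: chars balanced_coeff_commute)
  moreover have "finite {X. size X = m \<and> \<Sum>\<^sub># X = (0::'g)}" "finite {X. size X = n \<and> \<Sum>\<^sub># X = (0::'h)}"
    by (auto intro: finite_subset[OF _ finite_multisets_size_eq])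
  ultimately have "card {X \<in> {X. size X = m \<and> \<Sum>\<^sub># X = (0::'g)}. card (set_mset X) = k}
      = card {X \<in> {X. size X = n \<and> \<Sum>\<^sub># X = (0::'h)}. card (set_mset X) = k}"
    by (intro card_level_eq_if_sum_power_eq)
  then show ?thesis by (simp add: conj_assoc)
qed

subsection \<open>Faces of the zero-sum polytope\<close>

definition coord_vertices :: "'g::finite set \<Rightarrow> (real ^ 'g) set" where
  "coord_vertices c = (\<lambda>g. axis g 1) ` c"

definition open_coord_face :: "'g::finite set \<Rightarrow> (real ^ 'g) set" where
  "open_coord_face c = {x. (\<forall>g\<in>c. x $ g > 0) \<and> (\<forall>g. g \<notin> c \<longrightarrow> x $ g = 0) \<and> (\<Sum>g\<in>UNIV. x $ g) = 1}"

lemma inj_coord_axis: "inj_on (\<lambda>g. axis g (1::real)) c"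
  by (simp add: inj_on_def axis_eq_axis)

text \<open>The condition P is left open because t \<ge> 0 gives the convex hull and t > 0 its
  relative interior.\<close>

lemma coord_vertices_combinations:
  "{y. \<exists>u. (\<forall>x\<in>coord_vertices c. P (u x)) \<and> sum u (coord_vertices c) = 1 \<and>
        (\<Sum>x\<in>coord_vertices c. u x *\<^sub>R x) = y}
   = {y. (\<forall>g\<in>c. P (y $ g)) \<and> (\<forall>g. g \<notin> c \<longrightarrow> y $ g = 0) \<and> (\<Sum>g\<in>UNIV. y $ g) = 1}"
  (is "?L = ?R")
proof -
  have axis_nth: "axis h (1::real) $ g = (if g = h then 1 else 0)" for g h :: 'a
    by (simp add: axis_def)
  have comb: "(\<Sum>x\<in>coord_vertices c. u x *\<^sub>R x) $ g = (if g \<in> c then u (axis g 1) else 0)" for u g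
  proof -
    have "(\<Sum>x\<in>coord_vertices c. u x *\<^sub>R x) $ g = (\<Sum>h\<in>c. if g = h then u (axis h 1) else 0)"
      unfolding coord_vertices_def sum.reindex[OF inj_coord_axis] sum_component
      by (intro sum.cong) (auto simp: axis_nth)
    then show ?thesis by simp
  qed
  have sum_c: "(\<Sum>g\<in>UNIV. y $ g) = (\<Sum>g\<in>c. y $ g)" if "\<forall>g. g \<notin> c \<longrightarrow> y $ g = 0" for y :: "real ^ 'a"
    using that by (intro sum.mono_neutral_right) auto
  have sum_u: "sum u (coord_vertices c) = (\<Sum>g\<in>c. u (axis g 1))" for u :: "real ^ 'a \<Rightarrow> real"
    by (simp add: coord_vertices_def sum.reindex[OF inj_coord_axis])
  show ?thesis
  proof (intro equalityI subsetI)
    fix y assume "y \<in> ?L"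
    then obtain u where u: "\<forall>x\<in>coord_vertices c. P (u x)" "sum u (coord_vertices c) = 1"
      "(\<Sum>x\<in>coord_vertices c. u x *\<^sub>R x) = y" by auto
    have y: "y $ g = (if g \<in> c then u (axis g 1) else 0)" for g using comb[of u g] u(3) by simp
    then have "(\<Sum>g\<in>UNIV. y $ g) = (\<Sum>g\<in>c. u (axis g 1))" using sum_c[of y] by simp
    with u y show "y \<in> ?R" by (auto simp: sum_u) (auto simp: coord_vertices_def)
  next
    fix y assume y: "y \<in> ?R"
    \<comment> \<open>The inner product with a vertex reads off the barycentric coordinate
      there.\<close>
    define u where "u x = (y \<bullet> x)" for x
    have ug: "u (axis g 1) = y $ g" for g by (simp add: u_def inner_axis)
    have "(\<Sum>x\<in>coord_vertices c. u x *\<^sub>R x) = y" using y unfolding vec_eq_iff comb by (auto simp: ug)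
    moreover have "sum u (coord_vertices c) = 1" using y sum_c[of y] by (simp add: sum_u ug)
    moreover have "\<forall>x\<in>coord_vertices c. P (u x)" using y by (auto simp: coord_vertices_def ug)
    ultimately show "y \<in> ?L" by blast
  qed
qed

lemma affine_independent_coord_vertices: "\<not> affine_dependent (coord_vertices c)"
proof
  assume "affine_dependent (coord_vertices c)"
  then have "dependent (coord_vertices c)" by (rule affine_dependent_imp_dependent)
  moreover have "coord_vertices c \<subseteq> Basis" by (auto simp: coord_vertices_def axis_in_Basis_iff)
  ultimately show False using independent_Basis independent_mono by blast
qed

lemma convex_hull_coord_vertices:
  "convex hull (coord_vertices c) =
     {x. (\<forall>g\<in>c. x $ g \<ge> 0) \<and> (\<forall>g. g \<notin> c \<longrightarrow> x $ g = 0) \<and> (\<Sum>g\<in>UNIV. x $ g) = 1}"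
  using coord_vertices_combinations[of c "\<lambda>t. t \<ge> 0"]
  by (simp add: convex_hull_finite coord_vertices_def)

lemma rel_interior_coord_vertices:
  "rel_interior (convex hull (coord_vertices c)) = open_coord_face c"
  using coord_vertices_combinations[of c "\<lambda>t. t > 0"]
  by (simp add: rel_interior_convex_hull_explicit[OF affine_independent_coord_vertices] open_coord_face_def)

lemma coord_simplex_eq_convex_hull: "coord_simplex = convex hull (coord_vertices UNIV)"
  by (simp add: coord_simplex_def convex_hull_coord_vertices)

lemma aff_dim_coord_vertices: "aff_dim (convex hull (coord_vertices c)) = int (card c) - 1"
  using aff_dim_affine_independent[OF affine_independent_coord_vertices, of c]
  by (simp add: aff_dim_convex_hull coord_vertices_def card_image[OF inj_coord_axis])

text \<open>Allows a sum over faces to be reindexed by vertex sets.\<close>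

lemma inj_convex_hull_coord_vertices: "inj (\<lambda>c. convex hull (coord_vertices c))"
proof (rule injI)
  fix c c' :: "'a set"
  assume eq: "convex hull (coord_vertices c) = convex hull (coord_vertices c')"
  have "g \<in> d \<longleftrightarrow> axis g 1 \<in> convex hull (coord_vertices d)" for g and d :: "'a set"
  proof
    assume "g \<in> d"
    then show "axis g 1 \<in> convex hull (coord_vertices d)" by (intro hull_inc) (simp add: coord_vertices_def)
  next
    assume "axis g 1 \<in> convex hull (coord_vertices d)"
    then have "g \<notin> d \<longrightarrow> axis g (1::real) $ g = 0" unfolding convex_hull_coord_vertices by blast
    then show "g \<in> d" by auto
  qed
  with eq show "c = c'" by blast
qed

text \<open>Faces of a simplex are the hulls of its vertex subsets, k + 1 vertices span dimension k,
  and an injective linear map preserves faces and dimension.\<close>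

lemma faces_of_dim_zero_sum_polytope:
  fixes T :: "real ^ 'g::{finite, ab_group_add} \<Rightarrow> real ^ 'n::finite"
  assumes "linear T" "inj T"
  shows "faces_of_dim k (zero_sum_polytope T) = (\<lambda>c. T ` (convex hull (coord_vertices c))) ` {c. card c = Suc k}"
proof -
  have faces: "F face_of coord_simplex \<longleftrightarrow> (\<exists>c. F = convex hull (coord_vertices c))" for F :: "(real, 'g) vec set"
    unfolding coord_simplex_eq_convex_hull face_of_convex_hull_affine_independent[OF affine_independent_coord_vertices]
    by (auto simp: coord_vertices_def subset_image_iff)
  have "F \<in> faces_of_dim k (zero_sum_polytope T) \<longleftrightarrow>
      (\<exists>c. F = T ` (convex hull (coord_vertices c)) \<and> aff_dim F = int k)" for F
  proof -
    have "F \<in> {F. F face_of T ` coord_simplex} \<longleftrightarrow> F \<in> image T ` {F. F face_of coord_simplex}"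
      using faces_of_linear_image[OF assms, of coord_simplex] by simp
    then show ?thesis
      unfolding faces_of_dim_def zero_sum_polytope_def using faces by auto
  qed
  moreover have "aff_dim (T ` (convex hull (coord_vertices c))) = int k \<longleftrightarrow> card c = Suc k" for c
    using assms by (simp add: aff_dim_injective_linear_image aff_dim_coord_vertices) linarith
  ultimately show ?thesis by auto
qed

text \<open>T commutes with dilation and matches the two lattices, so all counting can be done in
  the coordinates of the group.\<close>

lemma card_dilate_lattice_iso:
  assumes T: "lattice_iso T"
  shows "card (dilate k (T ` X) \<inter> integer_points) = card (dilate k X \<inter> zero_sum_lattice)"
proof -
  have lin: "linear T" and inj: "inj T" and img: "T ` zero_sum_lattice = integer_points"
    using T by (auto simp: lattice_iso_def bij_def)
  have "dilate k (T ` X) \<inter> integer_points = T ` (dilate k X) \<inter> T ` zero_sum_lattice"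
    by (auto simp: dilate_def image_image linear_scale[OF lin] img)
  also have "\<dots> = T ` (dilate k X \<inter> zero_sum_lattice)" using inj by (simp add: image_Int)
  finally show ?thesis using inj by (simp add: card_image inj_on_subset)
qed

section \<open>Lattice points as multiplicity vectors\<close>

definition multiset_point :: "'g::finite multiset \<Rightarrow> real ^ 'g" where
  "multiset_point X = (\<chi> g. real (count X g))"

lemma inj_multiset_point: "inj multiset_point"
  by (rule injI) (simp add: multiset_point_def vec_eq_iff multiset_eq_iff)

lemma sum_mset_eq_sum_int_multiple:
  "\<Sum>\<^sub># X = (\<Sum>g\<in>UNIV. int_multiple (int (count X g)) (g::'g::{finite, ab_group_add}))"
proof -
  have "\<Sum>\<^sub># X = (\<Sum>g\<in>UNIV. nat_multiple (count X g) g)"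
  proof (induction X)
    case (add h X)
    have "(\<Sum>g\<in>UNIV. nat_multiple (count (add_mset h X) g) g) =
        (\<Sum>g\<in>UNIV. nat_multiple (count X g) g + (if g = h then g else 0))"
      by (intro sum.cong) auto
    then show ?case using add by (simp add: sum.distrib add.commute)
  qed simp
  then show ?thesis by (simp add: nat_multiple_def int_multiple_def)
qed

lemma size_eq_sum_count: "size X = (\<Sum>g\<in>UNIV. count X (g::'g::finite))"
  unfolding size_multiset_overloaded_eq by (intro sum.mono_neutral_left) (auto simp: not_in_iff)

lemma nonneg_zero_sum_lattice:
  "{x \<in> zero_sum_lattice. (\<forall>g. x $ g \<ge> 0) \<and> (\<Sum>g\<in>UNIV. x $ g) = real k}
   = multiset_point ` {X. size X = k \<and> \<Sum>\<^sub># X = (0::'g::{finite, ab_group_add})}" (is "?L = ?R")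
proof (intro equalityI subsetI)
  fix x :: "(real, 'g) vec" assume x: "x \<in> ?L"
  then obtain a where a: "x = (\<chi> g. real_of_int (a g))" "(\<Sum>g\<in>UNIV. int_multiple (a g) g) = 0"
    by (auto simp: zero_sum_lattice_def)
  define X where "X = Abs_multiset (\<lambda>g. nat (a g))"
  have nonneg: "a g \<ge> 0" for g using x a(1) by simp
  have "count X g = nat (a g)" for g by (simp add: X_def)
  then have cnt: "int (count X g) = a g" for g using nonneg by simp
  then have cnt_real: "real (count X g) = real_of_int (a g)" for g by (metis of_int_of_nat_eq)
  have "\<Sum>\<^sub># X = 0" using a(2) by (simp add: sum_mset_eq_sum_int_multiple cnt)
  moreover have "real (size X) = real k" using x a(1) by (simp add: size_eq_sum_count cnt_real)
  moreover have "x = multiset_point X" by (simp add: a(1) multiset_point_def cnt_real)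
  ultimately show "x \<in> ?R" by auto
next
  fix x assume "x \<in> ?R"
  then obtain X where X: "size X = k" "\<Sum>\<^sub># X = (0::'g)" "x = multiset_point X" by auto
  have "x \<in> zero_sum_lattice"
    unfolding zero_sum_lattice_def using X
    by (auto simp: multiset_point_def sum_mset_eq_sum_int_multiple intro!: exI[of _ "\<lambda>g. int (count X g)"])
  moreover have "(\<Sum>g\<in>UNIV. x $ g) = real (size X)" by (simp add: X(3) multiset_point_def size_eq_sum_count)
  ultimately show "x \<in> ?L" using X by (simp add: multiset_point_def)
qed

lemma mem_dilate_iff:
  fixes X :: "'a::real_vector set"
  assumes "k > 0"
  shows "x \<in> dilate k X \<longleftrightarrow> (1 / real k) *\<^sub>R x \<in> X"
  using assms by (force simp: dilate_def image_iff)

lemma dilate_coord_simplex_lattice: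
  assumes "k > 0"
  shows "dilate k coord_simplex \<inter> zero_sum_lattice
    = multiset_point ` {X. size X = k \<and> \<Sum>\<^sub># X = (0::'g::{finite, ab_group_add})}"
  unfolding nonneg_zero_sum_lattice[symmetric]
  using assms by (auto simp: mem_dilate_iff coord_simplex_def field_simps sum_divide_distrib[symmetric])

text \<open>Membership in the relative interior of a face prescribes exactly which coordinates are
  nonzero, that is, the support of the multiset.\<close>

lemma dilate_open_coord_face_lattice:
  assumes "k > 0"
  shows "dilate k (open_coord_face c) \<inter> zero_sum_lattice
    = multiset_point ` {X. size X = k \<and> \<Sum>\<^sub># X = (0::'g::{finite, ab_group_add}) \<and> set_mset X = c}"
proof -
  have "x \<in> dilate k (open_coord_face c) \<longleftrightarrow>
      {g. x $ g \<noteq> 0} = c \<and> (\<forall>g. x $ g \<ge> 0) \<and> (\<Sum>g\<in>UNIV. x $ g) = real k" for x :: "(real, 'g) vec"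
  proof -
    have "x \<in> dilate k (open_coord_face c) \<longleftrightarrow>
        (\<forall>g\<in>c. x $ g > 0) \<and> (\<forall>g. g \<notin> c \<longrightarrow> x $ g = 0) \<and> (\<Sum>g\<in>UNIV. x $ g) = real k"
      using assms by (auto simp: mem_dilate_iff open_coord_face_def field_simps sum_divide_distrib[symmetric])
    moreover have "(\<forall>g\<in>c. x $ g > 0) \<and> (\<forall>g. g \<notin> c \<longrightarrow> x $ g = 0) \<longleftrightarrow> {g. x $ g \<noteq> 0} = c \<and> (\<forall>g. x $ g \<ge> 0)"
      by (auto simp: less_le set_eq_iff)
    ultimately show ?thesis by blast
  qed
  then have "dilate k (open_coord_face c) \<inter> zero_sum_lattice = {x \<in> {x \<in> zero_sum_lattice. (\<forall>g. x $ g \<ge> 0) \<and>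
      (\<Sum>g\<in>UNIV. x $ g) = real k}. {g. x $ g \<noteq> 0} = c}" by blast
  also have "\<dots> = multiset_point ` {X. size X = k \<and> \<Sum>\<^sub># X = (0::'g) \<and> set_mset X = c}"
  proof -
    have "{g. multiset_point X $ g \<noteq> 0} = set_mset X" for X :: "'g multiset"
      by (auto simp: multiset_point_def)
    then show ?thesis unfolding nonneg_zero_sum_lattice by auto
  qed
  finally show ?thesis .
qed

lemma card_dilate_zero_sum_polytope:
  fixes T :: "real ^ 'g::{finite, ab_group_add} \<Rightarrow> real ^ 'n::finite"
  assumes "lattice_iso T" "m > 0"
  shows "card (dilate m (zero_sum_polytope T) \<inter> integer_points) = card {X. size X = m \<and> \<Sum>\<^sub># X = (0::'g)}"
  using assms
  by (simp add: zero_sum_polytope_def card_dilate_lattice_iso dilate_coord_simplex_lattice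
      card_image inj_on_subset[OF inj_multiset_point])

text \<open>The k-dimensional faces correspond to the supports of size k + 1, and these partition
  the multisets on the right.\<close>

lemma sum_card_dilate_faces:
  fixes T :: "real ^ 'g::{finite, ab_group_add} \<Rightarrow> real ^ 'n::finite"
  assumes T: "lattice_iso T" and m: "m > 0"
  shows "(\<Sum>F\<in>faces_of_dim k (zero_sum_polytope T). card (dilate m (rel_interior F) \<inter> integer_points))
    = card {X. size X = m \<and> \<Sum>\<^sub># X = (0::'g) \<and> card (set_mset X) = Suc k}"
proof -
  have lin: "linear T" and inj: "inj T" using T by (auto simp: lattice_iso_def bij_def)
  have inj_faces: "inj_on (\<lambda>c. T ` (convex hull (coord_vertices c))) C" for C
    using inj_convex_hull_coord_vertices inj by (auto simp: inj_on_def inj_image_eq_iff)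
  have "(\<Sum>F\<in>faces_of_dim k (zero_sum_polytope T). card (dilate m (rel_interior F) \<inter> integer_points))
      = (\<Sum>c | card c = Suc k. card (dilate m (T ` open_coord_face c) \<inter> integer_points))"
    unfolding faces_of_dim_zero_sum_polytope[OF lin inj] sum.reindex[OF inj_faces]
    using lin inj
    by (simp add: rel_interior_injective_linear_image linear_conv_bounded_linear[symmetric] rel_interior_coord_vertices)
  also have "\<dots> = (\<Sum>c | card c = Suc k. card {X. size X = m \<and> \<Sum>\<^sub># X = (0::'g) \<and> set_mset X = c})"
    using T m by (simp add: card_dilate_lattice_iso dilate_open_coord_face_lattice
        card_image inj_on_subset[OF inj_multiset_point])
  also have "\<dots> = card (\<Union>c\<in>{c. card c = Suc k}. {X. size X = m \<and> \<Sum>\<^sub># X = (0::'g) \<and> set_mset X = c})"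
    by (intro card_UN_disjoint[symmetric]) (auto intro: finite_subset[OF _ finite_multisets_size_eq[of m]])
  also have "(\<Union>c\<in>{c. card c = Suc k}. {X. size X = m \<and> \<Sum>\<^sub># X = (0::'g) \<and> set_mset X = c})
      = {X. size X = m \<and> \<Sum>\<^sub># X = (0::'g) \<and> card (set_mset X) = Suc k}" by auto
  finally show ?thesis .
qed

theorem theorem1p3:
  fixes T :: "real ^ 'g::{finite, ab_group_add} \<Rightarrow> real ^ 'n::finite"
    and S :: "real ^ 'h::{finite, ab_group_add} \<Rightarrow> real ^ 'm::finite"
    and n m :: nat
  assumes "CARD('g) = n" and "CARD('h) = m"
    and "lattice_iso T" and "lattice_iso S"
    and "card (dilate m (zero_sum_polytope T) \<inter> integer_points)
       = card (dilate n (zero_sum_polytope S) \<inter> integer_points)"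
  shows "\<forall>k::nat. k < min n m \<longrightarrow>
      (\<Sum>F\<in>faces_of_dim k (zero_sum_polytope T). card (dilate m (rel_interior F) \<inter> integer_points))
    = (\<Sum>F\<in>faces_of_dim k (zero_sum_polytope S). card (dilate n (rel_interior F) \<inter> integer_points))"
proof -
  have pos: "m > 0" "n > 0" using assms(1,2) by auto
  have "card {X. size X = m \<and> \<Sum>\<^sub># X = (0::'g)} = card {X. size X = n \<and> \<Sum>\<^sub># X = (0::'h)}"
    using assms(5) by (simp add: card_dilate_zero_sum_polytope assms(3,4) pos)
  from card_zero_sum_multisets_support_eq[OF assms(1,2) this] show ?thesis
    by (simp add: sum_card_dilate_faces assms(3,4) pos)
qed

end
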